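(* Let $d\ge 0$ be an integer, let $V_1,\ldots,V_{d+1}$ be pairwise disjoint finite sets, and put $V=V_1\sqcup\cdots\sqcup V_{d+1}$. Let $K\subseteq V_1*\cdots*V_{d+1}$ be Meshulam-admissible, and let $A:|\Delta_V|\to\mathbb R^d$ be a colorful Carathéodory map. Then there exists a face $\sigma\in K$ such that $0\in A(\sigma)$.
   Context: An abstract simplicial complex is a family of finite subsets (faces) of a ground set that is closed under taking subsets and contains $\varnothing$. For a finite set $V$, $\Delta_V:=2^V$ is the full simplex on $V$. $V_1*\cdots*V_m$ is the complex of all subsets of $V_1\sqcup\cdots\sqcup V_m$ containing at most one element of each $V_i$. For a complex $K$ on a finite vertex set $V$, each vertex $v$ is placed at the standard basis vector $e_v\in\mathbb R^V$; for $\sigma\in K$, $|\sigma|=\operatorname{conv}\{e_v:v\in\sigma\}$, $|\sigma|^\circ$ is its relative interior (the open simplex), and $|K|=\bigsqcup_{\sigma\in K}|\sigma|^\circ$. A map $A:|K|\to\mathbb R^d$ is affine if it is the affine extension over each face of its values on the vertices. For $\sigma\in K$ one writes $A(\sigma):=A(|\sigma|^\circ)$. An affine map $A:|\Delta_V|\to\mathbb R^d$, where $V=V_1\sqcup\cdots\sqcup V_{d+1}$, is a colorful Carathéodory map if $0\in A(V_i)$ for every $i=1,\dots,d+1$; here $V_i$ is regarded as a face of $\Delta_V$, so $A(V_i)=A(|V_i|^\circ)$. Homology is reduced simplicial homology with $\mathbb Z_2$ coefficients; in particular $\widetilde H_{-1}(K;\mathbb Z_2)=0$ if and only if $K$ has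 a vertex. For an integer $q$, a complex $K$ is homologically $q$-connected if $\widetilde H_i(K;\mathbb Z_2)=0$ for every $-1\le i\le q$. For a complex $K$ on ground set $V$ and $U\subseteq V$, $K[U]=\{\sigma\in K:\sigma\subseteq U\}$. Let $m\ge 1$, let $V_1,\ldots,V_m$ be pairwise disjoint finite sets and $V=V_1\sqcup\cdots\sqcup V_m$. A subcomplex $J\subseteq V_1*\cdots*V_m$, regarded as a complex on the ground set $V$, is Meshulam-admissible if: (1) $J$ is homologically $(m-2)$-connected; (2) for every proper subset $U\subsetneq V$ with $U\cap V_i\neq\varnothing$ for all $i\in\{1,\dots,m\}$, the induced subcomplex $J[U]$ is homologically $(m-3)$-connected. (In the claim, this is applied with $m=d+1$.) *)

theory Defs
  imports
    "HOL-Analysis.Analysis"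
    "HOL-Algebra.Elementary_Groups"
    "HOL-Library.Z2"
    "HOL-Library.Poly_Mapping"
begin

section \<open>Abstract simplicial complexes\<close>

text \<open>The empty face is always present; elements of the ground set \<open>V\<close> need not be vertices.\<close>

definition simplicial_complex_on :: "'v set \<Rightarrow> 'v set set \<Rightarrow> bool" where
  "simplicial_complex_on V K \<longleftrightarrow>
     {} \<in> K \<and> (\<forall>\<sigma>\<in>K. finite \<sigma> \<and> \<sigma> \<subseteq> V) \<and> (\<forall>\<sigma>\<in>K. \<forall>\<tau>. \<tau> \<subseteq> \<sigma> \<longrightarrow> \<tau> \<in> K)"

definition full_simplex :: "'v set \<Rightarrow> 'v set set" where
  "full_simplex V = Pow V"

text \<open>The complex \<open>V\<^sub>1 * \<dots> * V\<^sub>m\<close>.  The classes are indexed by \<open>{1..m}\<close>.\<close>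

definition colorful_join :: "nat \<Rightarrow> (nat \<Rightarrow> 'v set) \<Rightarrow> 'v set set" where
  "colorful_join m V =
     {\<sigma>. finite \<sigma> \<and> \<sigma> \<subseteq> (\<Union>i\<in>{1..m}. V i) \<and> (\<forall>i\<in>{1..m}. card (\<sigma> \<inter> V i) \<le> 1)}"

definition induced_subcomplex :: "'v set set \<Rightarrow> 'v set \<Rightarrow> 'v set set" where
  "induced_subcomplex K U = {\<sigma> \<in> K. \<sigma> \<subseteq> U}"


section \<open>Reduced simplicial homology with coefficients in the field of two elements\<close>

text \<open>
  Degrees are integers.  The empty face is the only face of dimension \<open>-1\<close>, which makes the
  chain complex the augmented one, and there are no faces of dimension below \<open>-1\<close>.
\<close>

definition faces_of_dim :: "'v set set \<Rightarrow> int \<Rightarrow> 'v set set" where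
  "faces_of_dim K i = {\<sigma> \<in> K. finite \<sigma> \<and> int (card \<sigma>) = i + 1}"

definition simplicial_chain_group :: "'v set set \<Rightarrow> int \<Rightarrow> ('v set \<Rightarrow>\<^sub>0 bit) monoid" where
  "simplicial_chain_group K i =
     \<lparr>carrier = {c. Poly_Mapping.keys c \<subseteq> faces_of_dim K i}, monoid.mult = (+), one = 0\<rparr>"

definition simplicial_boundary :: "('v set \<Rightarrow>\<^sub>0 bit) \<Rightarrow> ('v set \<Rightarrow>\<^sub>0 bit)" where
  "simplicial_boundary c =
     (\<Sum>\<sigma>\<in>Poly_Mapping.keys c. \<Sum>v\<in>\<sigma>. Poly_Mapping.single (\<sigma> - {v}) (Poly_Mapping.lookup c \<sigma>))"

definition simplicial_cycles :: "'v set set \<Rightarrow> int \<Rightarrow> ('v set \<Rightarrow>\<^sub>0 bit) set" where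
  "simplicial_cycles K i =
     kernel (simplicial_chain_group K i) (simplicial_chain_group K (i - 1)) simplicial_boundary"

definition simplicial_boundaries :: "'v set set \<Rightarrow> int \<Rightarrow> ('v set \<Rightarrow>\<^sub>0 bit) set" where
  "simplicial_boundaries K i = simplicial_boundary ` carrier (simplicial_chain_group K (i + 1))"

definition reduced_homology_group :: "'v set set \<Rightarrow> int \<Rightarrow> ('v set \<Rightarrow>\<^sub>0 bit) set monoid" where
  "reduced_homology_group K i =
     (simplicial_chain_group K i)\<lparr>carrier := simplicial_cycles K i\<rparr> Mod simplicial_boundaries K i"

definition homologically_connected :: "int \<Rightarrow> 'v set set \<Rightarrow> bool" where
  "homologically_connected q K \<longleftrightarrow>
     (\<forall>i. -1 \<le> i \<and> i \<le> q \<longrightarrow> trivial_group (reduced_homology_group K i))"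

definition Meshulam_admissible :: "nat \<Rightarrow> (nat \<Rightarrow> 'v set) \<Rightarrow> 'v set set \<Rightarrow> bool" where
  "Meshulam_admissible m V J \<longleftrightarrow>
     simplicial_complex_on (\<Union>i\<in>{1..m}. V i) J \<and>
     J \<subseteq> colorful_join m V \<and>
     homologically_connected (int m - 2) J \<and>
     (\<forall>U. U \<subset> (\<Union>i\<in>{1..m}. V i) \<and> (\<forall>i\<in>{1..m}. U \<inter> V i \<noteq> {}) \<longrightarrow>
        homologically_connected (int m - 3) (induced_subcomplex J U))"


section \<open>Geometric realizations and affine maps\<close>

text \<open>
  Vertices are drawn from a finite type \<open>'v\<close>, and \<open>\<real>\<^sup>V\<close> is the coordinate subspace of
  \<open>real ^ 'v\<close> belonging to \<open>V\<close>.  The type need not be exhausted by \<open>V\<close>.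
\<close>

definition closed_simplex :: "'v::finite set \<Rightarrow> (real ^ 'v) set" where
  "closed_simplex \<sigma> = convex hull ((\<lambda>v. axis v 1) ` \<sigma>)"

definition open_simplex :: "'v::finite set \<Rightarrow> (real ^ 'v) set" where
  "open_simplex \<sigma> = rel_interior (closed_simplex \<sigma>)"

definition geometric_realization :: "'v::finite set set \<Rightarrow> (real ^ 'v) set" where
  "geometric_realization K = (\<Union>\<sigma>\<in>K. open_simplex \<sigma>)"

text \<open>
  The target \<open>\<real>\<^sup>d\<close> is the space underlying \<^term>\<open>Euclidean_space d\<close>, i.e. the
  functions on the naturals vanishing from \<open>d\<close> on, since \<open>d = 0\<close> has to be allowed.  A point of a
  closed simplex has its own coordinates as barycentric coordinates.
\<close>

definition affine_map :: "'v::finite set set \<Rightarrow> nat \<Rightarrow> (real ^ 'v \<Rightarrow> nat \<Rightarrow> real) \<Rightarrow> bool" where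
  "affine_map K d A \<longleftrightarrow>
     A \<in> geometric_realization K \<rightarrow> topspace (Euclidean_space d) \<and>
     (\<forall>\<sigma>\<in>K. \<forall>x\<in>closed_simplex \<sigma>. \<forall>j. A x j = (\<Sum>v\<in>\<sigma>. x $ v * A (axis v 1) j))"

definition face_image :: "(real ^ 'v::finite \<Rightarrow> nat \<Rightarrow> real) \<Rightarrow> 'v set \<Rightarrow> (nat \<Rightarrow> real) set" where
  "face_image A \<sigma> = A ` open_simplex \<sigma>"

definition colorful_Caratheodory_map ::
    "nat \<Rightarrow> (nat \<Rightarrow> 'v::finite set) \<Rightarrow> (real ^ 'v \<Rightarrow> nat \<Rightarrow> real) \<Rightarrow> bool" where
  "colorful_Caratheodory_map d V A \<longleftrightarrow>
     affine_map (full_simplex (\<Union>i\<in>{1..d+1}. V i)) d A \<and>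
     (\<forall>i\<in>{1..d+1}. (\<lambda>_. 0) \<in> face_image A (V i))"


section \<open>Basic facts\<close>

lemma simplicial_boundary_superset:
  assumes "finite S" "Poly_Mapping.keys c \<subseteq> S"
  shows "simplicial_boundary c =
    (\<Sum>\<sigma>\<in>S. \<Sum>v\<in>\<sigma>. Poly_Mapping.single (\<sigma> - {v}) (Poly_Mapping.lookup c \<sigma>))"
  unfolding simplicial_boundary_def
  by (rule sum.mono_neutral_left) (use assms in \<open>auto simp: in_keys_iff\<close>)

lemma simplicial_boundary_zero [simp]: "simplicial_boundary 0 = 0"
  by (simp add: simplicial_boundary_def)

lemma simplicial_boundary_add:
  "simplicial_boundary (c + c') = simplicial_boundary c + simplicial_boundary c'"
proof -
  let ?S = "Poly_Mapping.keys c \<union> Poly_Mapping.keys c'"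
  have "Poly_Mapping.keys (c + c') \<subseteq> ?S" by (rule Poly_Mapping.keys_add)
  then have "simplicial_boundary (c + c') = (\<Sum>\<sigma>\<in>?S. \<Sum>v\<in>\<sigma>.
      Poly_Mapping.single (\<sigma> - {v}) (Poly_Mapping.lookup (c + c') \<sigma>))"
    by (intro simplicial_boundary_superset) auto
  also have "\<dots> = (\<Sum>\<sigma>\<in>?S. \<Sum>v\<in>\<sigma>. Poly_Mapping.single (\<sigma> - {v}) (Poly_Mapping.lookup c \<sigma>)) +
      (\<Sum>\<sigma>\<in>?S. \<Sum>v\<in>\<sigma>. Poly_Mapping.single (\<sigma> - {v}) (Poly_Mapping.lookup c' \<sigma>))"
    by (simp only: lookup_add single_add sum.distrib)
  also have "\<dots> = simplicial_boundary c + simplicial_boundary c'"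
    by (intro arg_cong2[of _ _ _ _ plus] simplicial_boundary_superset[symmetric]) auto
  finally show ?thesis .
qed

lemma simplicial_boundary_sum:
  "simplicial_boundary (sum f S) = (\<Sum>x\<in>S. simplicial_boundary (f x))"
  by (induction S rule: infinite_finite_induct) (simp_all add: simplicial_boundary_add)

lemma simplicial_boundary_single:
  "simplicial_boundary (Poly_Mapping.single \<tau> a) = (\<Sum>v\<in>\<tau>. Poly_Mapping.single (\<tau> - {v}) a)"
  by (subst simplicial_boundary_superset[of "{\<tau>}"]) auto

lemma bit_chain_double [simp]: "c + c = 0" for c :: "'a \<Rightarrow>\<^sub>0 bit"
  by (rule poly_mapping_eqI) (simp add: lookup_add)

lemma sum_symmetric_pairs_bit:
  fixes g :: "'b \<Rightarrow> 'b \<Rightarrow> 'a \<Rightarrow>\<^sub>0 bit"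
  assumes "finite S" and sym: "\<And>v w. g v w = g w v"
  shows "(\<Sum>v\<in>S. \<Sum>w\<in>S - {v}. g v w) = 0"
  using assms(1)
proof induction
  case (insert a F)
  have "(\<Sum>v\<in>F. \<Sum>w\<in>insert a F - {v}. g v w) = (\<Sum>v\<in>F. g a v + (\<Sum>w\<in>F - {v}. g v w))"
  proof (rule sum.cong)
    fix v assume "v \<in> F"
    with insert have "insert a F - {v} = insert a (F - {v})" "a \<notin> F - {v}" by auto
    with insert show "(\<Sum>w\<in>insert a F - {v}. g v w) = g a v + (\<Sum>w\<in>F - {v}. g v w)"
      by (simp add: sym[of v a])
  qed simp
  moreover have "insert a F - {a} = F" using insert by auto
  ultimately show ?case
    using insert by (simp add: sum.distrib flip: add.assoc)
qed simp

lemma simplicial_boundary_boundary: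
  assumes "\<And>\<sigma>. \<sigma> \<in> Poly_Mapping.keys c \<Longrightarrow> finite \<sigma>"
  shows "simplicial_boundary (simplicial_boundary c) = 0"
proof -
  have "(\<Sum>v\<in>\<sigma>. \<Sum>w\<in>\<sigma> - {v}. Poly_Mapping.single (\<sigma> - {v} - {w}) a) = 0"
    if "finite \<sigma>" for \<sigma> :: "'a set" and a :: bit
    by (rule sum_symmetric_pairs_bit[OF that]) (metis Diff_insert Diff_insert2)
  then show ?thesis
    unfolding simplicial_boundary_def[of c]
    by (simp add: simplicial_boundary_sum simplicial_boundary_single assms)
qed

lemma simplicial_boundary_in_chain_group:
  assumes "simplicial_complex_on V K" "c \<in> carrier (simplicial_chain_group K (i + 1))"
  shows "simplicial_boundary c \<in> carrier (simplicial_chain_group K i)"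
proof -
  have "\<tau> \<in> faces_of_dim K i" if \<tau>: "\<tau> \<in> Poly_Mapping.keys (simplicial_boundary c)" for \<tau>
  proof -
    obtain \<sigma> where \<sigma>: "\<sigma> \<in> Poly_Mapping.keys c"
      and \<tau>\<sigma>: "\<tau> \<in> Poly_Mapping.keys
        (\<Sum>v\<in>\<sigma>. Poly_Mapping.single (\<sigma> - {v}) (Poly_Mapping.lookup c \<sigma>))"
      using subsetD[OF keys_sum \<tau>[unfolded simplicial_boundary_def]] by (elim UN_E)
    obtain v where v: "v \<in> \<sigma>"
      and "\<tau> \<in> Poly_Mapping.keys (Poly_Mapping.single (\<sigma> - {v}) (Poly_Mapping.lookup c \<sigma>))"
      using subsetD[OF keys_sum \<tau>\<sigma>] by (elim UN_E)
    then have \<tau>v: "\<tau> = \<sigma> - {v}" by (simp split: if_splits)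
    have "\<sigma> \<in> faces_of_dim K (i + 1)"
      using assms(2) \<sigma> unfolding simplicial_chain_group_def by (simp add: subsetD)
    then have K: "\<sigma> \<in> K" "finite \<sigma>" and c: "int (card \<sigma>) = i + 2"
      unfolding faces_of_dim_def by simp_all
    have "\<sigma> - {v} \<in> K"
      using assms(1) K(1) unfolding simplicial_complex_on_def by (meson Diff_subset)
    moreover have "int (card (\<sigma> - {v})) = i + 1"
      using card_Suc_Diff1[OF K(2) v] c by linarith
    ultimately show ?thesis
      using K(2) by (simp add: faces_of_dim_def \<tau>v)
  qed
  then show ?thesis unfolding simplicial_chain_group_def by (simp add: subsetI)
qed

lemma comm_group_simplicial_chain_group: "comm_group (simplicial_chain_group K i)"
proof (rule comm_groupI)
  show "x \<otimes>\<^bsub>simplicial_chain_group K i\<^esub> y \<in> carrier (simplicial_chain_group K i)"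
    if "x \<in> carrier (simplicial_chain_group K i)" "y \<in> carrier (simplicial_chain_group K i)" for x y
    using that Poly_Mapping.keys_add[of x y]
    unfolding simplicial_chain_group_def by fastforce
  show "\<exists>y\<in>carrier (simplicial_chain_group K i).
      y \<otimes>\<^bsub>simplicial_chain_group K i\<^esub> x = \<one>\<^bsub>simplicial_chain_group K i\<^esub>"
    if "x \<in> carrier (simplicial_chain_group K i)" for x
    using that by (intro bexI[of _ x]) (simp_all add: simplicial_chain_group_def)
qed (simp_all add: simplicial_chain_group_def add.assoc add.commute)

lemma simplicial_cycles_iff:
  "c \<in> simplicial_cycles K i \<longleftrightarrow>
     Poly_Mapping.keys c \<subseteq> faces_of_dim K i \<and> simplicial_boundary c = 0"
  by (simp add: simplicial_cycles_def kernel_def simplicial_chain_group_def)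

lemma subgroup_simplicial_cycles: "subgroup (simplicial_cycles K i) (simplicial_chain_group K i)"
proof -
  interpret comm_group "simplicial_chain_group K i" by (rule comm_group_simplicial_chain_group)
  have inv: "inv\<^bsub>simplicial_chain_group K i\<^esub> x = x" if "x \<in> simplicial_cycles K i" for x
    by (rule inv_equality) (use that in \<open>simp_all add: simplicial_cycles_iff simplicial_chain_group_def\<close>)
  show ?thesis
  proof
    show "simplicial_cycles K i \<subseteq> carrier (simplicial_chain_group K i)"
      by (simp add: simplicial_cycles_iff simplicial_chain_group_def subset_iff)
    show "x \<otimes>\<^bsub>simplicial_chain_group K i\<^esub> y \<in> simplicial_cycles K i"
      if "x \<in> simplicial_cycles K i" "y \<in> simplicial_cycles K i" for x y
      using that Poly_Mapping.keys_add[of x y]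
      unfolding simplicial_cycles_iff simplicial_chain_group_def
      by (fastforce simp: simplicial_boundary_add)
    show "\<one>\<^bsub>simplicial_chain_group K i\<^esub> \<in> simplicial_cycles K i"
      by (simp add: simplicial_cycles_iff simplicial_chain_group_def)
    show "inv\<^bsub>simplicial_chain_group K i\<^esub> x \<in> simplicial_cycles K i"
      if "x \<in> simplicial_cycles K i" for x using inv[OF that] that by simp
  qed
qed

lemma normal_simplicial_boundaries:
  assumes K: "simplicial_complex_on V K"
  shows "simplicial_boundaries K i \<lhd>
    (simplicial_chain_group K i)\<lparr>carrier := simplicial_cycles K i\<rparr>"
    (is "?B \<lhd> ?Z")
proof -
  interpret C: comm_group "simplicial_chain_group K i" by (rule comm_group_simplicial_chain_group)
  interpret Z: comm_group ?Z
  proof (rule group.group_comm_groupI)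
    show "group ?Z" by (rule C.subgroup_imp_group) (rule subgroup_simplicial_cycles)
  qed (simp add: simplicial_chain_group_def add.commute)
  have sub: "?B \<subseteq> simplicial_cycles K i"
  proof
    fix b assume "b \<in> ?B"
    then obtain c where c: "c \<in> carrier (simplicial_chain_group K (i + 1))"
        and b: "b = simplicial_boundary c"
      by (auto simp: simplicial_boundaries_def)
    have "simplicial_boundary b = 0"
      unfolding b using c
      by (intro simplicial_boundary_boundary) (auto simp: simplicial_chain_group_def faces_of_dim_def)
    with simplicial_boundary_in_chain_group[OF K c] b show "b \<in> simplicial_cycles K i"
      by (simp add: simplicial_cycles_iff simplicial_chain_group_def)
  qed
  have inv: "inv\<^bsub>?Z\<^esub> x = x" if "x \<in> simplicial_cycles K i" for x
    by (rule Z.inv_equality) (use that in \<open>simp_all add: simplicial_chain_group_def\<close>)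
  have "subgroup ?B ?Z"
  proof
    show "?B \<subseteq> carrier ?Z" using sub by simp
    show "x \<otimes>\<^bsub>?Z\<^esub> y \<in> ?B" if xy: "x \<in> ?B" "y \<in> ?B" for x y
    proof -
      obtain c c' where c: "c \<in> carrier (simplicial_chain_group K (i + 1))"
          "c' \<in> carrier (simplicial_chain_group K (i + 1))"
        and e: "x = simplicial_boundary c" "y = simplicial_boundary c'"
        using xy by (auto simp: simplicial_boundaries_def)
      have "c + c' \<in> carrier (simplicial_chain_group K (i + 1))"
        using c Poly_Mapping.keys_add[of c c'] by (auto simp: simplicial_chain_group_def)
      moreover have "x \<otimes>\<^bsub>?Z\<^esub> y = simplicial_boundary (c + c')"
        by (simp add: e simplicial_boundary_add simplicial_chain_group_def)
      ultimately show ?thesis by (simp add: simplicial_boundaries_def)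
    qed
    show "\<one>\<^bsub>?Z\<^esub> \<in> ?B"
      unfolding simplicial_boundaries_def
      by (rule image_eqI[of _ _ 0]) (simp_all add: simplicial_chain_group_def)
    show "inv\<^bsub>?Z\<^esub> x \<in> ?B" if "x \<in> ?B" for x
      using inv[of x] sub that by auto
  qed
  then show ?thesis by (rule Z.subgroup_imp_normal)
qed

lemma trivial_reduced_homology_group_iff:
  assumes "simplicial_complex_on V K"
  shows "trivial_group (reduced_homology_group K i) \<longleftrightarrow>
    simplicial_cycles K i \<subseteq> simplicial_boundaries K i"
proof -
  let ?Z = "(simplicial_chain_group K i)\<lparr>carrier := simplicial_cycles K i\<rparr>"
  let ?B = "simplicial_boundaries K i"
  interpret normal ?B ?Z by (rule normal_simplicial_boundaries[OF assms])
  have one: "\<one>\<^bsub>?Z Mod ?B\<^esub> = ?B" by (simp add: FactGroup_def)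
  have car: "carrier (?Z Mod ?B) = (\<lambda>x. ?B #>\<^bsub>?Z\<^esub> x) ` simplicial_cycles K i"
    by (auto simp: FactGroup_def RCOSETS_def)
  have "trivial_group (?Z Mod ?B) \<longleftrightarrow> carrier (?Z Mod ?B) = {?B}"
    using factorgroup_is_group by (simp add: trivial_group_def one)
  also have "\<dots> \<longleftrightarrow> (\<forall>x\<in>simplicial_cycles K i. ?B #>\<^bsub>?Z\<^esub> x = ?B)"
    using subgroup.one_closed[OF subgroup_simplicial_cycles[of K i]] unfolding car by blast
  also have "\<dots> \<longleftrightarrow> simplicial_cycles K i \<subseteq> ?B"
  proof -
    have "?B #>\<^bsub>?Z\<^esub> x = ?B \<longleftrightarrow> x \<in> ?B" if "x \<in> simplicial_cycles K i" for x
      using that rcos_self[of x] coset_join2[of x ?B] subgroup_axioms by auto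
    then show ?thesis by blast
  qed
  finally show ?thesis by (simp add: reduced_homology_group_def)
qed

lemma trivial_reduced_homology_group_minus_one_iff:
  assumes K: "simplicial_complex_on V K"
  shows "trivial_group (reduced_homology_group K (-1)) \<longleftrightarrow> (\<exists>v. {v} \<in> K)"
proof
  assume "trivial_group (reduced_homology_group K (-1))"
  moreover have "Poly_Mapping.single {} 1 \<in> simplicial_cycles K (-1)"
    using K by (simp add: simplicial_cycles_iff faces_of_dim_def simplicial_complex_on_def
        simplicial_boundary_single)
  ultimately obtain c where c: "Poly_Mapping.keys c \<subseteq> faces_of_dim K 0"
      "Poly_Mapping.single {} 1 = simplicial_boundary c"
    using trivial_reduced_homology_group_iff[OF K]
    by (auto simp: simplicial_boundaries_def simplicial_chain_group_def)
  have "c \<noteq> 0"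
    using c(2) by (metis simplicial_boundary_zero lookup_single_eq lookup_zero zero_neq_one)
  then obtain \<sigma> where "\<sigma> \<in> faces_of_dim K 0" using c(1) by fastforce
  then show "\<exists>v. {v} \<in> K"
    by (auto simp: faces_of_dim_def card_1_singleton_iff)
next
  assume "\<exists>v. {v} \<in> K"
  then obtain v where v: "{v} \<in> K" ..
  have "simplicial_cycles K (-1) \<subseteq> simplicial_boundaries K (-1)"
  proof
    fix c assume "c \<in> simplicial_cycles K (-1)"
    then have k: "Poly_Mapping.keys c \<subseteq> {{}}"
      by (auto simp: simplicial_cycles_iff faces_of_dim_def)
    have "c = Poly_Mapping.single {} (Poly_Mapping.lookup c {})"
    proof (rule poly_mapping_eqI)
      fix \<sigma>
      have "\<sigma> \<noteq> {} \<Longrightarrow> Poly_Mapping.lookup c \<sigma> = 0"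
        using k by (meson in_keys_iff singletonD subsetD)
      then show "Poly_Mapping.lookup c \<sigma> =
          Poly_Mapping.lookup (Poly_Mapping.single {} (Poly_Mapping.lookup c {})) \<sigma>"
        by (cases "\<sigma> = {}") (simp_all add: lookup_single when_def del: bit_not_zero_iff bit_not_one_iff)
    qed
    also have "\<dots> = simplicial_boundary (Poly_Mapping.single {v} (Poly_Mapping.lookup c {}))"
      by (simp add: simplicial_boundary_single)
    finally have "c = simplicial_boundary (Poly_Mapping.single {v} (Poly_Mapping.lookup c {}))" .
    then show "c \<in> simplicial_boundaries K (-1)"
      unfolding simplicial_boundaries_def
      by (rule image_eqI) (use v in \<open>simp add: simplicial_chain_group_def faces_of_dim_def\<close>)
  qed
  then show "trivial_group (reduced_homology_group K (-1))"
    by (simp add: trivial_reduced_homology_group_iff[OF K])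
qed

lemma axis_one_independent: "independent ((\<lambda>v. axis v (1::real)) ` (\<sigma> :: 'v::finite set))"
  by (rule independent_mono[OF independent_Basis]) (auto simp: axis_in_Basis_iff)

lemma open_simplex_iff:
  "x \<in> open_simplex \<sigma> \<longleftrightarrow>
     (\<forall>v\<in>\<sigma>. 0 < x $ v) \<and> (\<forall>v. v \<notin> \<sigma> \<longrightarrow> x $ v = 0) \<and> (\<Sum>v\<in>\<sigma>. x $ v) = 1"
proof -
  let ?e = "\<lambda>v. axis v (1::real)"
  have inj: "inj_on ?e \<sigma>" by (auto simp: inj_on_def axis_eq_axis)
  have "\<not> affine_dependent (?e ` \<sigma>)"
    using axis_one_independent affine_dependent_imp_dependent by blast
  then have os: "open_simplex \<sigma> = {y. \<exists>u. (\<forall>v\<in>\<sigma>. 0 < u (?e v)) \<and>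
      (\<Sum>v\<in>\<sigma>. u (?e v)) = 1 \<and> (\<Sum>v\<in>\<sigma>. u (?e v) *\<^sub>R ?e v) = y}"
    by (simp add: open_simplex_def closed_simplex_def rel_interior_convex_hull_explicit
        sum.reindex[OF inj])
  have comp: "(\<Sum>v\<in>\<sigma>. f v *\<^sub>R ?e v) $ w = (if w \<in> \<sigma> then f w else 0)" for f w
  proof -
    have "(\<Sum>v\<in>\<sigma>. f v *\<^sub>R ?e v) $ w = (\<Sum>v\<in>\<sigma>. if v = w then f v else 0)"
      unfolding sum_component by (rule sum.cong) (auto simp: axis_def)
    then show ?thesis by simp
  qed
  have wit: "\<exists>u. (\<forall>v\<in>\<sigma>. 0 < u (?e v)) \<and> (\<Sum>v\<in>\<sigma>. u (?e v)) = 1 \<and>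
      (\<Sum>v\<in>\<sigma>. u (?e v) *\<^sub>R ?e v) = x"
    if x: "\<forall>v\<in>\<sigma>. 0 < x $ v" "\<forall>v. v \<notin> \<sigma> \<longrightarrow> x $ v = 0" "(\<Sum>v\<in>\<sigma>. x $ v) = 1"
  proof (intro exI[of _ "\<lambda>y. x $ (the_inv_into \<sigma> ?e y)"] conjI)
    have i: "the_inv_into \<sigma> ?e (?e v) = v" if "v \<in> \<sigma>" for v
      by (rule the_inv_into_f_f[OF inj that])
    show "\<forall>v\<in>\<sigma>. 0 < x $ the_inv_into \<sigma> ?e (?e v)" using x i by simp
    show "(\<Sum>v\<in>\<sigma>. x $ the_inv_into \<sigma> ?e (?e v)) = 1" using x i by simp
    have "(\<Sum>v\<in>\<sigma>. x $ the_inv_into \<sigma> ?e (?e v) *\<^sub>R ?e v) = (\<Sum>v\<in>\<sigma>. x $ v *\<^sub>R ?e v)"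
      by (rule sum.cong) (simp_all add: i)
    also have "\<dots> = x"
      unfolding vec_eq_iff comp using x by simp
    finally show "(\<Sum>v\<in>\<sigma>. x $ the_inv_into \<sigma> ?e (?e v) *\<^sub>R ?e v) = x" .
  qed
  have eq: "x \<in> open_simplex \<sigma> \<longleftrightarrow> (\<exists>u. (\<forall>v\<in>\<sigma>. 0 < u (?e v)) \<and>
      (\<Sum>v\<in>\<sigma>. u (?e v)) = 1 \<and> (\<Sum>v\<in>\<sigma>. u (?e v) *\<^sub>R ?e v) = x)"
    by (simp only: os mem_Collect_eq)
  show ?thesis
  proof
    assume "x \<in> open_simplex \<sigma>"
    then obtain u where u: "\<forall>v\<in>\<sigma>. 0 < u (?e v)" "(\<Sum>v\<in>\<sigma>. u (?e v)) = 1"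
        "(\<Sum>v\<in>\<sigma>. u (?e v) *\<^sub>R ?e v) = x"
      unfolding eq by (elim exE conjE)
    have "x $ w = (if w \<in> \<sigma> then u (?e w) else 0)" for w
      unfolding u(3)[symmetric] by (rule comp)
    with u show "(\<forall>v\<in>\<sigma>. 0 < x $ v) \<and> (\<forall>v. v \<notin> \<sigma> \<longrightarrow> x $ v = 0) \<and> (\<Sum>v\<in>\<sigma>. x $ v) = 1"
      by simp
  qed (unfold eq, elim conjE, rule wit)
qed

end

theory Submission
  imports Defs
begin

text \<open>
  Suppose no face of \<open>K\<close> captures the origin, and let \<open>W\<close> be the linear span of the images \<open>a v\<close> of
  the vertices, of dimension \<open>n \<le> d\<close>. For nonzero \<open>y \<in> W\<close> the set \<open>U\<^sub>y = {v. 0 \<le> y \<bullet> a v}\<close> meets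
  every class, as \<open>0\<close> is a positive combination of each class, and it is proper, as \<open>y\<close> is not
  orthogonal to \<open>W\<close>; so \<open>K[U\<^sub>y]\<close> is homologically \<open>(d - 2)\<close>-connected. Take a fine \<open>(n - 1)\<close>-cycle \<open>c\<close>
  subdividing the boundary of a simplex around the origin of \<open>W\<close>. The connectivity
  gives a chain map \<open>f\<close> from \<open>c\<close> to \<open>K\<close> carrying a small simplex around \<open>y\<close> into \<open>K[U\<^sub>y]\<close>. Since \<open>y\<close>
  and the points of \<open>f\<close> near \<open>y\<close> lie in one half-space, \<open>c\<close> and \<open>f c\<close> are homologous away from the
  origin, and \<open>f c\<close> bounds in \<open>K\<close>, that is, again away from the origin. So the simplex around the
  origin is completed to an \<open>n\<close>-cycle in \<open>W\<close> by simplices avoiding the origin. This is impossible: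
  the simplices of a mod 2 \<open>n\<close>-cycle in an \<open>n\<close>-dimensional space cover every generic point an even
  number of times.
\<close>

section \<open>Chains and acyclic carriers\<close>

text \<open>The linear extension of a map given on simplices. Over the field of two elements a
  nonzero coefficient is 1, so the sum over the support carries no coefficients.\<close>

definition chain_ext :: "('a set \<Rightarrow> 'b set \<Rightarrow>\<^sub>0 bit) \<Rightarrow> ('a set \<Rightarrow>\<^sub>0 bit) \<Rightarrow> ('b set \<Rightarrow>\<^sub>0 bit)" where
  "chain_ext g c = (\<Sum>\<sigma>\<in>Poly_Mapping.keys c. g \<sigma>)"

lemma chain_ext_superset:
  assumes "finite S" "Poly_Mapping.keys c \<subseteq> S"
  shows "chain_ext g c = (\<Sum>\<sigma>\<in>S. if Poly_Mapping.lookup c \<sigma> = 0 then 0 else g \<sigma>)"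
proof -
  have "chain_ext g c = (\<Sum>\<sigma>\<in>Poly_Mapping.keys c. if Poly_Mapping.lookup c \<sigma> = 0 then 0 else g \<sigma>)"
    unfolding chain_ext_def by (rule sum.cong) (auto simp: in_keys_iff simp del: bit_not_zero_iff bit_not_one_iff)
  also have "\<dots> = (\<Sum>\<sigma>\<in>S. if Poly_Mapping.lookup c \<sigma> = 0 then 0 else g \<sigma>)"
    by (rule sum.mono_neutral_left) (use assms in \<open>auto simp: in_keys_iff\<close>)
  finally show ?thesis .
qed

lemma chain_ext_zero [simp]: "chain_ext g 0 = 0"
  by (simp add: chain_ext_def)

lemma chain_ext_single [simp]: "chain_ext g (Poly_Mapping.single \<tau> 1) = g \<tau>"
  by (simp add: chain_ext_def)

lemma chain_ext_add: "chain_ext g (c + c') = chain_ext g c + chain_ext g c'"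
proof -
  let ?S = "Poly_Mapping.keys c \<union> Poly_Mapping.keys c'"
  have "chain_ext g (c + c') = (\<Sum>\<sigma>\<in>?S. if Poly_Mapping.lookup (c + c') \<sigma> = 0 then 0 else g \<sigma>)"
    using Poly_Mapping.keys_add[of c c'] by (intro chain_ext_superset) auto
  also have "\<dots> = (\<Sum>\<sigma>\<in>?S. (if Poly_Mapping.lookup c \<sigma> = 0 then 0 else g \<sigma>) +
      (if Poly_Mapping.lookup c' \<sigma> = 0 then 0 else g \<sigma>))"
    by (rule sum.cong) (auto simp: lookup_add)
  also have "\<dots> = chain_ext g c + chain_ext g c'"
    unfolding sum.distrib by (intro arg_cong2[of _ _ _ _ plus] chain_ext_superset[symmetric]) auto
  finally show ?thesis .
qed

lemma chain_ext_sum: "chain_ext g (sum f S) = (\<Sum>x\<in>S. chain_ext g (f x))"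
  by (induction S rule: infinite_finite_induct) (simp_all add: chain_ext_add)

lemma chain_eq_sum_single: "c = (\<Sum>\<sigma>\<in>Poly_Mapping.keys c. Poly_Mapping.single \<sigma> 1)"
  for c :: "'a \<Rightarrow>\<^sub>0 bit"
proof (rule poly_mapping_eqI)
  fix \<tau>
  have "Poly_Mapping.lookup (\<Sum>\<sigma>\<in>Poly_Mapping.keys c. Poly_Mapping.single \<sigma> 1) \<tau> =
      (\<Sum>\<sigma>\<in>Poly_Mapping.keys c. if \<sigma> = \<tau> then (1::bit) else 0)"
    unfolding lookup_sum by (rule sum.cong) (auto simp: lookup_single when_def)
  then show "Poly_Mapping.lookup c \<tau> =
      Poly_Mapping.lookup (\<Sum>\<sigma>\<in>Poly_Mapping.keys c. Poly_Mapping.single \<sigma> 1) \<tau>"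
    by (cases "Poly_Mapping.lookup c \<tau>")
      (simp_all add: in_keys_iff del: bit_not_zero_iff bit_not_one_iff)
qed

lemma keys_chain_ext: "Poly_Mapping.keys (chain_ext g c) \<subseteq> (\<Union>\<sigma>\<in>Poly_Mapping.keys c. Poly_Mapping.keys (g \<sigma>))"
  unfolding chain_ext_def by (rule keys_sum)

lemma chain_ext_boundary:
  "chain_ext g (simplicial_boundary c) = (\<Sum>\<sigma>\<in>Poly_Mapping.keys c. \<Sum>v\<in>\<sigma>. g (\<sigma> - {v}))"
proof -
  have "simplicial_boundary c = (\<Sum>\<sigma>\<in>Poly_Mapping.keys c. \<Sum>v\<in>\<sigma>. Poly_Mapping.single (\<sigma> - {v}) 1)"
    using arg_cong[OF chain_eq_sum_single[of c], of simplicial_boundary]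
    by (simp only: simplicial_boundary_sum simplicial_boundary_single)
  then show ?thesis by (simp add: chain_ext_sum)
qed

text \<open>Turns the simplexwise identities produced by \<open>carrier_chain_map\<close> into
  identities of chains: for \<open>g = 0\<close> the extension of \<open>G\<close> commutes with the
  boundary, for \<open>g = f + f'\<close> this is the homotopy formula (signs vanish mod 2).\<close>

lemma boundary_chain_ext:
  assumes "\<And>\<sigma>. \<sigma> \<in> Poly_Mapping.keys c \<Longrightarrow>
    simplicial_boundary (G \<sigma>) = g \<sigma> + (\<Sum>v\<in>\<sigma>. G (\<sigma> - {v}))"
  shows "simplicial_boundary (chain_ext G c) = chain_ext g c + chain_ext G (simplicial_boundary c)"
  unfolding chain_ext_boundary
  unfolding chain_ext_def simplicial_boundary_sum sum.distrib[symmetric]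
  by (rule sum.cong[OF refl]) (rule assms)

lemma chain_ext_plus: "chain_ext (\<lambda>\<sigma>. g \<sigma> + h \<sigma>) c = chain_ext g c + chain_ext h c"
  by (simp add: chain_ext_def sum.distrib)

lemma chain_ext_id: "chain_ext (\<lambda>\<sigma>. Poly_Mapping.single \<sigma> 1) c = c"
  unfolding chain_ext_def by (rule chain_eq_sum_single[symmetric])

section \<open>Cones and push-forwards of chains\<close>

definition cone_chain :: "'a \<Rightarrow> ('a set \<Rightarrow>\<^sub>0 bit) \<Rightarrow> ('a set \<Rightarrow>\<^sub>0 bit)" where
  "cone_chain b = chain_ext (\<lambda>\<sigma>. if b \<in> \<sigma> then 0 else Poly_Mapping.single (insert b \<sigma>) 1)"

lemma keys_cone_chain:
  "\<sigma> \<in> Poly_Mapping.keys (cone_chain b c) \<Longrightarrow> \<exists>\<tau>\<in>Poly_Mapping.keys c. b \<notin> \<tau> \<and> \<sigma> = insert b \<tau>"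
  unfolding cone_chain_def by (drule subsetD[OF keys_chain_ext]) (auto split: if_splits)

text \<open>The usual cone formula. It holds for all simplices, also those containing the apex
  \<open>b\<close>, because degenerate cones are set to 0 and, in the augmented complex, a vertex
  also has the empty face as boundary.\<close>

lemma boundary_cone_chain:
  assumes "\<And>\<sigma>. \<sigma> \<in> Poly_Mapping.keys c \<Longrightarrow> finite \<sigma>"
  shows "simplicial_boundary (cone_chain b c) = c + cone_chain b (simplicial_boundary c)"
proof -
  let ?g = "\<lambda>\<sigma>. if b \<in> \<sigma> then 0 else Poly_Mapping.single (insert b \<sigma>) (1::bit)"
  have "simplicial_boundary (?g \<sigma>) = Poly_Mapping.single \<sigma> 1 + (\<Sum>v\<in>\<sigma>. ?g (\<sigma> - {v}))"
    if "\<sigma> \<in> Poly_Mapping.keys c" for \<sigma>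
  proof (cases "b \<in> \<sigma>")
    case True
    \<comment> \<open>Only the facet opposite \<open>b\<close> has a nondegenerate cone, and that
      cone is \<open>\<sigma>\<close> itself, which cancels the first summand.\<close>
    have "(\<Sum>v\<in>\<sigma>. ?g (\<sigma> - {v})) = ?g (\<sigma> - {b}) + (\<Sum>v\<in>\<sigma>-{b}. ?g (\<sigma> - {v}))"
      using True assms[OF that] by (simp add: sum.remove)
    also have "(\<Sum>v\<in>\<sigma>-{b}. ?g (\<sigma> - {v})) = 0"
      by (rule sum.neutral) (use True in auto)
    also have "?g (\<sigma> - {b}) + 0 = Poly_Mapping.single \<sigma> 1"
      using True by (simp add: insert_absorb)
    finally show ?thesis using True by simp
  next
    case False
    have "(\<Sum>v\<in>\<sigma>. Poly_Mapping.single (insert b \<sigma> - {v}) 1) =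
        (\<Sum>v\<in>\<sigma>. Poly_Mapping.single (insert b (\<sigma> - {v})) (1::bit))"
      by (rule sum.cong) (use False in \<open>auto intro: arg_cong2[of _ _ _ _ Poly_Mapping.single]\<close>)
    with False assms[OF that] show ?thesis by (simp add: simplicial_boundary_single)
  qed
  from boundary_chain_ext[where G="?g" and g="\<lambda>\<sigma>. Poly_Mapping.single \<sigma> 1", OF this]
  show ?thesis unfolding cone_chain_def
    unfolding chain_ext_def chain_eq_sum_single[symmetric] .
qed

text \<open>Push-forward along a vertex map. Collapsed simplices are not sent to 0, so it is a chain
  map only for injective \<open>j\<close>.\<close>

definition push_chain :: "('a \<Rightarrow> 'b) \<Rightarrow> ('a set \<Rightarrow>\<^sub>0 bit) \<Rightarrow> ('b set \<Rightarrow>\<^sub>0 bit)" where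
  "push_chain j = chain_ext (\<lambda>\<sigma>. Poly_Mapping.single (j ` \<sigma>) 1)"

lemma keys_push_chain: "Poly_Mapping.keys (push_chain j c) \<subseteq> (`) j ` Poly_Mapping.keys c"
  unfolding push_chain_def by (rule order_trans[OF keys_chain_ext]) auto

lemma boundary_push_chain:
  assumes "inj j"
  shows "simplicial_boundary (push_chain j c) = push_chain j (simplicial_boundary c)"
proof -
  have "simplicial_boundary (Poly_Mapping.single (j ` \<sigma>) 1) =
      0 + (\<Sum>v\<in>\<sigma>. Poly_Mapping.single (j ` (\<sigma> - {v})) (1::bit))" for \<sigma>
    using assms by (simp add: simplicial_boundary_single sum.reindex inj_on_subset
        image_set_diff)
  from boundary_chain_ext[OF this] show ?thesis
    by (simp add: push_chain_def) (simp add: chain_ext_def)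
qed

lemma push_chain_add: "push_chain j (c + c') = push_chain j c + push_chain j c'"
  by (simp add: push_chain_def chain_ext_add)

lemma push_chain_sum: "push_chain j (sum f S) = (\<Sum>x\<in>S. push_chain j (f x))"
  by (simp add: push_chain_def chain_ext_sum)

lemma push_chain_single: "push_chain j (Poly_Mapping.single \<sigma> 1) = Poly_Mapping.single (j ` \<sigma>) 1"
  by (simp add: push_chain_def)

text \<open>
  With \<open>m = 0\<close> and \<open>g = 0\<close> this extends an augmentation \<open>G0\<close> to a chain map; with \<open>m = 1\<close> and
  \<open>g = f + f'\<close> it yields a chain homotopy between the chain maps \<open>f\<close> and \<open>f'\<close>.
\<close>

lemma carrier_chain_map:
  fixes g :: "'a set \<Rightarrow> 'b set \<Rightarrow>\<^sub>0 bit" and \<Phi> :: "'a set \<Rightarrow> 'b set set"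
  assumes down: "\<And>\<tau> v. \<tau> \<in> S \<Longrightarrow> v \<in> \<tau> \<Longrightarrow> \<tau> - {v} \<in> S"
    and fin: "\<And>\<tau>. \<tau> \<in> S \<Longrightarrow> finite \<tau>"
    and mono: "\<And>\<tau> v. \<tau> \<in> S \<Longrightarrow> v \<in> \<tau> \<Longrightarrow> \<Phi> (\<tau> - {v}) \<subseteq> \<Phi> \<tau>"
    and g: "\<And>\<tau>. \<tau> \<in> S \<Longrightarrow> Poly_Mapping.keys (g \<tau>) \<subseteq> {\<sigma>\<in>\<Phi> \<tau>. Suc (card \<sigma>) = card \<tau> + m}"
    and dg: "\<And>\<tau>. \<tau> \<in> S \<Longrightarrow> simplicial_boundary (g \<tau>) = (\<Sum>v\<in>\<tau>. g (\<tau> - {v}))"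
    and base: "Poly_Mapping.keys G0 \<subseteq> {\<sigma>\<in>\<Phi> {}. card \<sigma> = m}" "simplicial_boundary G0 = g {}"
    and fill: "\<And>\<tau> z. \<lbrakk>\<tau> \<in> S; \<tau> \<noteq> {}; card \<tau> \<le> N; simplicial_boundary z = 0;
        Poly_Mapping.keys z \<subseteq> {\<sigma>\<in>\<Phi> \<tau>. Suc (card \<sigma>) = card \<tau> + m}\<rbrakk> \<Longrightarrow>
        \<exists>u. Poly_Mapping.keys u \<subseteq> {\<sigma>\<in>\<Phi> \<tau>. card \<sigma> = card \<tau> + m} \<and> simplicial_boundary u = z"
  shows "\<exists>G. G {} = G0 \<and> (\<forall>\<tau>\<in>S. card \<tau> \<le> N \<longrightarrow>
      Poly_Mapping.keys (G \<tau>) \<subseteq> {\<sigma>\<in>\<Phi> \<tau>. card \<sigma> = card \<tau> + m} \<and>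
      simplicial_boundary (G \<tau>) = g \<tau> + (\<Sum>v\<in>\<tau>. G (\<tau> - {v})))"
  using fill
proof (induction N)
  case 0
  show ?case
  proof (intro exI[of _ "\<lambda>_. G0"] conjI ballI impI)
    fix \<tau> assume "\<tau> \<in> S" "card \<tau> \<le> 0"
    then have "\<tau> = {}" using fin by simp
    then show "Poly_Mapping.keys G0 \<subseteq> {\<sigma>\<in>\<Phi> \<tau>. card \<sigma> = card \<tau> + m}"
        "simplicial_boundary G0 = g \<tau> + (\<Sum>v\<in>\<tau>. G0)"
      using base by simp_all
  qed simp
next
  case (Suc N)
  have "\<exists>G. G {} = G0 \<and> (\<forall>\<tau>\<in>S. card \<tau> \<le> N \<longrightarrow>
      Poly_Mapping.keys (G \<tau>) \<subseteq> {\<sigma>\<in>\<Phi> \<tau>. card \<sigma> = card \<tau> + m} \<and>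
      simplicial_boundary (G \<tau>) = g \<tau> + (\<Sum>v\<in>\<tau>. G (\<tau> - {v})))"
    by (rule Suc.IH) (rule Suc.prems, simp_all)
  then obtain G where G0: "G {} = G0"
    and keys: "\<And>\<tau>. \<tau> \<in> S \<Longrightarrow> card \<tau> \<le> N \<Longrightarrow>
      Poly_Mapping.keys (G \<tau>) \<subseteq> {\<sigma>\<in>\<Phi> \<tau>. card \<sigma> = card \<tau> + m}"
    and bd: "\<And>\<tau>. \<tau> \<in> S \<Longrightarrow> card \<tau> \<le> N \<Longrightarrow> simplicial_boundary (G \<tau>) = g \<tau> + (\<Sum>v\<in>\<tau>. G (\<tau> - {v}))"
    by blast
  have ex: "\<exists>u. Poly_Mapping.keys u \<subseteq> {\<sigma>\<in>\<Phi> \<tau>. card \<sigma> = card \<tau> + m} \<and>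
      simplicial_boundary u = g \<tau> + (\<Sum>v\<in>\<tau>. G (\<tau> - {v}))" if \<tau>: "\<tau> \<in> S" "card \<tau> = Suc N" for \<tau>
  proof (rule Suc.prems)
    have c: "card (\<tau> - {v}) = N" if "v \<in> \<tau>" for v
      using \<tau>(2) that by (simp add: card_Diff_singleton)
    show "Poly_Mapping.keys (g \<tau> + (\<Sum>v\<in>\<tau>. G (\<tau> - {v}))) \<subseteq> {\<sigma>\<in>\<Phi> \<tau>. Suc (card \<sigma>) = card \<tau> + m}"
    proof -
      have "Poly_Mapping.keys (G (\<tau> - {v})) \<subseteq> {\<sigma>\<in>\<Phi> \<tau>. Suc (card \<sigma>) = card \<tau> + m}" if "v \<in> \<tau>" for v
        using keys[OF down[OF \<tau>(1) that]] mono[OF \<tau>(1) that] c[OF that] \<tau>(2) by fastforce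
      then have "Poly_Mapping.keys (\<Sum>v\<in>\<tau>. G (\<tau> - {v})) \<subseteq> {\<sigma>\<in>\<Phi> \<tau>. Suc (card \<sigma>) = card \<tau> + m}"
        by (intro order_trans[OF keys_sum]) blast
      with g[OF \<tau>(1)] show ?thesis by (intro order_trans[OF Poly_Mapping.keys_add]) blast
    qed
    \<comment> \<open>The prescribed boundary is a cycle: the terms in \<open>g\<close> cancel by
      \<open>dg\<close>, and each term \<open>G (\<tau> - {v} - {w})\<close> occurs twice, once for
      either order of deletion.\<close>
    have "(\<Sum>v\<in>\<tau>. \<Sum>w\<in>\<tau> - {v}. G (\<tau> - {v} - {w})) = 0"
      by (rule sum_symmetric_pairs_bit[OF fin[OF \<tau>(1)]]) (metis Diff_insert Diff_insert2)
    moreover have "(\<Sum>v\<in>\<tau>. simplicial_boundary (G (\<tau> - {v}))) =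
        (\<Sum>v\<in>\<tau>. g (\<tau> - {v}) + (\<Sum>w\<in>\<tau> - {v}. G (\<tau> - {v} - {w})))"
      by (rule sum.cong[OF refl], rule bd) (use down[OF \<tau>(1)] c in auto)
    ultimately show "simplicial_boundary (g \<tau> + (\<Sum>v\<in>\<tau>. G (\<tau> - {v}))) = 0"
      unfolding simplicial_boundary_add simplicial_boundary_sum dg[OF \<tau>(1)] sum.distrib
      by (simp only: bit_chain_double add_0_right)
    show "\<tau> \<noteq> {}" using \<tau>(2) by auto
  qed (use \<tau> in simp_all)
  define F where "F \<tau> = (SOME u. Poly_Mapping.keys u \<subseteq> {\<sigma>\<in>\<Phi> \<tau>. card \<sigma> = card \<tau> + m} \<and>
      simplicial_boundary u = g \<tau> + (\<Sum>v\<in>\<tau>. G (\<tau> - {v})))" for \<tau>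
  have F: "Poly_Mapping.keys (F \<tau>) \<subseteq> {\<sigma>\<in>\<Phi> \<tau>. card \<sigma> = card \<tau> + m}"
      "simplicial_boundary (F \<tau>) = g \<tau> + (\<Sum>v\<in>\<tau>. G (\<tau> - {v}))" if "\<tau> \<in> S" "card \<tau> = Suc N" for \<tau>
    using someI_ex[OF ex[OF that]] unfolding F_def by auto
  define G' where "G' \<tau> = (if card \<tau> = Suc N then F \<tau> else G \<tau>)" for \<tau>
  have below: "G' (\<tau> - {v}) = G (\<tau> - {v})" if "\<tau> \<in> S" "card \<tau> \<le> Suc N" "v \<in> \<tau>" for \<tau> v
    using that fin[of \<tau>] by (auto simp: G'_def card_Diff_singleton)
  show ?case
  proof (intro exI[of _ G'] conjI ballI impI)
    fix \<tau> assume \<tau>: "\<tau> \<in> S" "card \<tau> \<le> Suc N"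
    then have "(\<Sum>v\<in>\<tau>. G' (\<tau> - {v})) = (\<Sum>v\<in>\<tau>. G (\<tau> - {v}))"
      by (intro sum.cong below) auto
    then show "simplicial_boundary (G' \<tau>) = g \<tau> + (\<Sum>v\<in>\<tau>. G' (\<tau> - {v}))"
      using \<tau> F[of \<tau>] bd[of \<tau>] by (auto simp: G'_def)
    show "Poly_Mapping.keys (G' \<tau>) \<subseteq> {\<sigma>\<in>\<Phi> \<tau>. card \<sigma> = card \<tau> + m}"
      using \<tau> F(1)[of \<tau>] keys[of \<tau>] unfolding G'_def by (cases "card \<tau> = Suc N") auto
  qed (simp add: G'_def G0)
qed

text \<open>The cone over \<open>z\<close> with apex \<open>b\<close> fills \<open>z\<close>, since
  the cone over its zero boundary vanishes. \<open>\<Phi>\<close> must only absorb the apex. This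
  supplies the hypothesis \<open>fill\<close> of \<open>carrier_chain_map\<close> for geometric
  carriers.\<close>

lemma cycle_bounds_if_cone_closed:
  assumes dz: "simplicial_boundary z = 0"
    and z: "Poly_Mapping.keys z \<subseteq> {\<sigma>\<in>\<Phi>. Suc (card \<sigma>) = n}"
    and \<Phi>: "\<And>\<sigma>. \<sigma> \<in> \<Phi> \<Longrightarrow> finite \<sigma> \<and> insert b \<sigma> \<in> \<Phi>"
  shows "\<exists>u. Poly_Mapping.keys u \<subseteq> {\<sigma>\<in>\<Phi>. card \<sigma> = n} \<and> simplicial_boundary u = z"
proof (intro exI conjI subsetI)
  have z': "\<tau> \<in> \<Phi> \<and> finite \<tau> \<and> insert b \<tau> \<in> \<Phi> \<and> Suc (card \<tau>) = n" if "\<tau> \<in> Poly_Mapping.keys z" for \<tau>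
    using subsetD[OF z that] \<Phi>[of \<tau>] by simp
  show "\<sigma> \<in> {\<sigma>\<in>\<Phi>. card \<sigma> = n}" if \<sigma>: "\<sigma> \<in> Poly_Mapping.keys (cone_chain b z)" for \<sigma>
  proof -
    from keys_cone_chain[OF \<sigma>] obtain \<tau> where \<tau>: "\<tau> \<in> Poly_Mapping.keys z" "b \<notin> \<tau>" "\<sigma> = insert b \<tau>"
      by (elim bexE conjE)
    then show ?thesis using z'[OF \<tau>(1)] by simp
  qed
  have "simplicial_boundary (cone_chain b z) = z + cone_chain b (simplicial_boundary z)"
    by (rule boundary_cone_chain) (simp add: z')
  then show "simplicial_boundary (cone_chain b z) = z"
    by (simp add: dz cone_chain_def)
qed

text \<open>Restates vanishing homology as a filling property in terms of cardinalities; faces with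
  \<open>n\<close> vertices have dimension \<open>n - 1\<close>, which accounts for the bound on
  \<open>q\<close>.\<close>

lemma homologically_connected_cycle_bounds:
  assumes K: "simplicial_complex_on V K" and conn: "homologically_connected q K" "int n - 1 \<le> q"
    and z: "simplicial_boundary z = 0" "Poly_Mapping.keys z \<subseteq> {\<sigma>\<in>K. card \<sigma> = n}"
  shows "\<exists>u. Poly_Mapping.keys u \<subseteq> {\<sigma>\<in>K. card \<sigma> = Suc n} \<and> simplicial_boundary u = z"
proof -
  have fin: "finite \<sigma>" if "\<sigma> \<in> K" for \<sigma> using K that by (simp add: simplicial_complex_on_def)
  have "z \<in> simplicial_cycles K (int n - 1)"
    using z fin by (auto simp: simplicial_cycles_iff faces_of_dim_def)
  moreover have "simplicial_cycles K (int n - 1) \<subseteq> simplicial_boundaries K (int n - 1)"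
    using conn by (simp add: homologically_connected_def flip: trivial_reduced_homology_group_iff[OF K])
  ultimately obtain u where "u \<in> carrier (simplicial_chain_group K (int n - 1 + 1))"
      "z = simplicial_boundary u"
    unfolding simplicial_boundaries_def by blast
  then show ?thesis
    by (intro exI[of _ u]) (auto simp: simplicial_chain_group_def faces_of_dim_def)
qed

section \<open>Subdivision\<close>

text \<open>For \<open>k = card \<tau>\<close>, the vector from a vertex to the barycenter averages
  \<open>k\<close> differences, one of which is zero, so its norm is at most
  \<open>(k - 1) / k\<close> times the diameter. Balls are convex, so the estimate extends from the
  vertices to the hull. The slightly weaker ratio \<open>N / (N + 1)\<close> has a positive
  denominator for every \<open>N\<close>.\<close>

lemma barycenter_near:
  fixes \<tau> :: "'e::real_normed_vector set"
  assumes fin: "finite \<tau>" "\<tau> \<noteq> {}" "card \<tau> \<le> N"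
  defines "b \<equiv> (1 / real (card \<tau>)) *\<^sub>R \<Sum>\<tau>"
  shows "b \<in> convex hull \<tau>"
    and "x \<in> convex hull \<tau> \<Longrightarrow> dist b x \<le> real N / real (Suc N) * diameter \<tau>"
proof -
  have k: "card \<tau> > 0" using fin by (simp add: card_gt_0_iff)
  have b: "b = (\<Sum>x\<in>\<tau>. (1 / real (card \<tau>)) *\<^sub>R x)"
    by (simp add: b_def scaleR_sum_right)
  show "b \<in> convex hull \<tau>"
    unfolding b using k fin by (intro convex_sum) (auto simp: hull_inc convex_convex_hull)
  have bd: "bounded \<tau>" using fin by (simp add: finite_imp_bounded)
  have D: "0 \<le> diameter \<tau>" using bd by (rule diameter_ge_0)
  have "dist b w \<le> real N / real (Suc N) * diameter \<tau>" if w: "w \<in> \<tau>" for w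
  proof -
    have "b - w = (1 / real (card \<tau>)) *\<^sub>R (\<Sum>x\<in>\<tau>. x - w)"
      using k by (simp add: b_def sum_subtractf scaleR_diff_right sum_constant_scaleR del: sum_constant)
    then have "dist b w = (1 / real (card \<tau>)) * norm (\<Sum>x\<in>\<tau>. x - w)"
      by (simp add: dist_norm)
    also have "(\<Sum>x\<in>\<tau>. x - w) = (\<Sum>x\<in>\<tau> - {w}. x - w)"
      using fin w by (simp add: sum.remove)
    also have "norm \<dots> \<le> (\<Sum>x\<in>\<tau> - {w}. norm (x - w))" by (rule norm_sum)
    also have "\<dots> \<le> (\<Sum>x\<in>\<tau> - {w}. diameter \<tau>)"
      by (rule sum_mono) (use diameter_bounded_bound[OF bd _ w] in \<open>auto simp: dist_norm\<close>)
    also have "\<dots> = (real (card \<tau>) - 1) * diameter \<tau>"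
      using fin w k by (simp add: card_Diff_singleton of_nat_diff)
    finally have "dist b w \<le> (1 / real (card \<tau>)) * ((real (card \<tau>) - 1) * diameter \<tau>)"
      using k by (simp add: divide_right_mono)
    also have "\<dots> = ((real (card \<tau>) - 1) / real (card \<tau>)) * diameter \<tau>" by simp
    also have "\<dots> \<le> real N / real (Suc N) * diameter \<tau>"
    proof (rule mult_right_mono[OF _ D])
      have "(real (card \<tau>) - 1) / real (card \<tau>) = 1 - 1 / real (card \<tau>)"
        using k by (simp add: field_simps)
      also have "\<dots> \<le> 1 - 1 / real (Suc N)"
        using k fin by (intro diff_mono divide_left_mono) auto
      also have "\<dots> = real N / real (Suc N)" by (simp add: field_simps)
      finally show "(real (card \<tau>) - 1) / real (card \<tau>) \<le> real N / real (Suc N)" .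
    qed
    finally show ?thesis .
  qed
  then have "convex hull \<tau> \<subseteq> cball b (real N / real (Suc N) * diameter \<tau>)"
    by (intro hull_minimal) auto
  then show "x \<in> convex hull \<tau> \<Longrightarrow> dist b x \<le> real N / real (Suc N) * diameter \<tau>" by auto
qed

text \<open>Carriers replace an explicit barycentric subdivision: the subdivision operator is any
  chain map carried by the small simplices in each hull, and \<open>h\<close> comes from a chain
  homotopy to the identity carried by all simplices in the hull. Simplices are mere vertex sets and
  may be affinely dependent.\<close>

lemma subdivision_step:
  fixes c :: "'e::real_normed_vector set \<Rightarrow>\<^sub>0 bit"
  assumes dc: "simplicial_boundary c = 0"
    and simplices: "\<forall>\<tau>\<in>Poly_Mapping.keys c. finite \<tau> \<and> card \<tau> = N"
  shows "\<exists>c' h. simplicial_boundary c' = 0 \<and> simplicial_boundary h = c + c' \<and>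
    (\<forall>\<rho>\<in>Poly_Mapping.keys c'. finite \<rho> \<and> card \<rho> = N \<and> (\<exists>\<tau>\<in>Poly_Mapping.keys c. \<rho> \<subseteq> convex hull \<tau> \<and>
       diameter \<rho> \<le> real N / real (Suc N) * diameter \<tau>)) \<and>
    (\<forall>\<rho>\<in>Poly_Mapping.keys h. finite \<rho> \<and> card \<rho> = Suc N \<and> (\<exists>\<tau>\<in>Poly_Mapping.keys c. \<rho> \<subseteq> convex hull \<tau>))"
proof -
  note c = bspec[OF simplices]
  define q where "q = real N / real (Suc N)"
  have q: "0 \<le> q" by (simp add: q_def)
  define S where "S = {\<tau> :: 'e set. finite \<tau> \<and> card \<tau> \<le> N}"
  define \<Phi> where "\<Phi> \<tau> = {\<rho> :: 'e set. finite \<rho> \<and> \<rho> \<subseteq> convex hull \<tau>}" for \<tau>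
  define \<Psi> where "\<Psi> \<tau> = {\<rho>\<in>\<Phi> \<tau>. \<forall>x\<in>\<rho>. \<forall>y\<in>\<rho>. dist x y \<le> q * diameter \<tau>}" for \<tau>
  have SI: "\<tau> - {v} \<in> S" if "\<tau> \<in> S" for \<tau> v
    using that card_Diff1_le[of \<tau> v] by (auto simp: S_def)
  have S: "finite \<tau>" "card \<tau> \<le> N" "bounded \<tau>" if "\<tau> \<in> S" for \<tau>
    using that by (auto simp: S_def finite_imp_bounded)
  have mono: "\<Phi> (\<tau> - {v}) \<subseteq> \<Phi> \<tau>" for \<tau> v
    using hull_mono[of "\<tau> - {v}" \<tau> convex] by (auto simp: \<Phi>_def)
  have mono': "\<Psi> (\<tau> - {v}) \<subseteq> \<Psi> \<tau>" if "\<tau> \<in> S" for \<tau> v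
  proof -
    have "q * diameter (\<tau> - {v}) \<le> q * diameter \<tau>"
      by (rule mult_left_mono[OF diameter_subset]) (use S[OF that] q in auto)
    then show ?thesis using mono[of \<tau> v] unfolding \<Psi>_def by (auto intro: order_trans)
  qed
  \<comment> \<open>The subdivision operator \<open>G\<close>.\<close>
  have "\<exists>G. G {} = Poly_Mapping.single {} 1 \<and> (\<forall>\<tau>\<in>S. card \<tau> \<le> N \<longrightarrow>
      Poly_Mapping.keys (G \<tau>) \<subseteq> {\<sigma>\<in>\<Psi> \<tau>. card \<sigma> = card \<tau> + 0} \<and>
      simplicial_boundary (G \<tau>) = 0 + (\<Sum>v\<in>\<tau>. G (\<tau> - {v})))"
  proof (rule carrier_chain_map)
    fix \<tau> z
    assume \<tau>: "\<tau> \<in> S" "\<tau> \<noteq> {}" "card \<tau> \<le> N" and z: "simplicial_boundary z = 0"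
        "Poly_Mapping.keys z \<subseteq> {\<sigma> \<in> \<Psi> \<tau>. Suc (card \<sigma>) = card \<tau> + 0}"
    note b = barycenter_near[OF S(1)[OF \<tau>(1)] \<tau>(2,3), folded q_def]
    have d: "0 \<le> q * diameter \<tau>" using q S[OF \<tau>(1)] by (simp add: diameter_ge_0)
    show "\<exists>u. Poly_Mapping.keys u \<subseteq> {\<sigma> \<in> \<Psi> \<tau>. card \<sigma> = card \<tau> + 0} \<and> simplicial_boundary u = z"
      \<comment> \<open>Coning from the barycenter preserves the distance bound, since every vertex
        involved lies in the hull of \<open>\<tau>\<close>.\<close>
      by (rule cycle_bounds_if_cone_closed[OF z, of "(1 / real (card \<tau>)) *\<^sub>R \<Sum>\<tau>"])
        (use b d in \<open>auto simp: \<Psi>_def \<Phi>_def dist_commute subset_iff\<close>)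
  next
    show "\<Psi> (\<tau> - {v}) \<subseteq> \<Psi> \<tau>" if "\<tau> \<in> S" for \<tau> v by (rule mono'[OF that])
  qed (simp_all add: SI S \<Psi>_def \<Phi>_def simplicial_boundary_single)
  then obtain G where G0: "G {} = Poly_Mapping.single {} 1"
    and G: "\<And>\<tau>. \<tau> \<in> S \<Longrightarrow> Poly_Mapping.keys (G \<tau>) \<subseteq> {\<sigma>\<in>\<Psi> \<tau>. card \<sigma> = card \<tau>}"
    and dG: "\<And>\<tau>. \<tau> \<in> S \<Longrightarrow> simplicial_boundary (G \<tau>) = 0 + (\<Sum>v\<in>\<tau>. G (\<tau> - {v}))"
    using S by auto
  \<comment> \<open>The chain homotopy \<open>H\<close> between the identity and \<open>G\<close>.
    Its carrier has no size restriction, so any vertex of \<open>\<tau>\<close> can serve as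
    apex.\<close>
  have "\<exists>H. H {} = 0 \<and> (\<forall>\<tau>\<in>S. card \<tau> \<le> N \<longrightarrow>
      Poly_Mapping.keys (H \<tau>) \<subseteq> {\<sigma>\<in>\<Phi> \<tau>. card \<sigma> = card \<tau> + 1} \<and>
      simplicial_boundary (H \<tau>) = (Poly_Mapping.single \<tau> 1 + G \<tau>) + (\<Sum>v\<in>\<tau>. H (\<tau> - {v})))"
  proof (rule carrier_chain_map)
    fix \<tau> assume \<tau>: "\<tau> \<in> S"
    show "simplicial_boundary (Poly_Mapping.single \<tau> 1 + G \<tau>) =
        (\<Sum>v\<in>\<tau>. Poly_Mapping.single (\<tau> - {v}) 1 + G (\<tau> - {v}))"
      by (simp add: simplicial_boundary_add simplicial_boundary_single dG[OF \<tau>] sum.distrib)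
    have "\<tau> \<in> \<Phi> \<tau>" using \<tau> by (auto simp: \<Phi>_def S_def hull_inc)
    then show "Poly_Mapping.keys (Poly_Mapping.single \<tau> 1 + G \<tau>) \<subseteq>
        {\<sigma> \<in> \<Phi> \<tau>. Suc (card \<sigma>) = card \<tau> + 1}"
      using G[OF \<tau>] by (intro order_trans[OF Poly_Mapping.keys_add]) (auto simp: \<Psi>_def)
  next
    fix \<tau> z
    assume \<tau>: "\<tau> \<in> S" "\<tau> \<noteq> {}" "card \<tau> \<le> N" and z: "simplicial_boundary z = 0"
        "Poly_Mapping.keys z \<subseteq> {\<sigma> \<in> \<Phi> \<tau>. Suc (card \<sigma>) = card \<tau> + 1}"
    obtain b where "b \<in> \<tau>" using \<tau>(2) by blast
    then show "\<exists>u. Poly_Mapping.keys u \<subseteq> {\<sigma> \<in> \<Phi> \<tau>. card \<sigma> = card \<tau> + 1} \<and> simplicial_boundary u = z"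
      by (intro cycle_bounds_if_cone_closed[OF z, of b]) (auto simp: \<Phi>_def hull_inc)
  next
    show "\<Phi> (\<tau> - {v}) \<subseteq> \<Phi> \<tau>" for \<tau> v by (rule mono)
  qed (simp_all add: SI S G0)
  then obtain H where H: "\<And>\<tau>. \<tau> \<in> S \<Longrightarrow> Poly_Mapping.keys (H \<tau>) \<subseteq> {\<sigma>\<in>\<Phi> \<tau>. card \<sigma> = card \<tau> + 1}"
    and dH: "\<And>\<tau>. \<tau> \<in> S \<Longrightarrow> simplicial_boundary (H \<tau>) =
        (Poly_Mapping.single \<tau> 1 + G \<tau>) + (\<Sum>v\<in>\<tau>. H (\<tau> - {v}))"
    using S(2) by blast
  have cS: "\<tau> \<in> S" if "\<tau> \<in> Poly_Mapping.keys c" for \<tau> using c[OF that] by (simp add: S_def)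
  show ?thesis
  proof (intro exI conjI ballI)
    show "simplicial_boundary (chain_ext G c) = 0"
      using boundary_chain_ext[of c G "\<lambda>_. 0", OF dG[OF cS]] dc by (simp add: chain_ext_def)
    show "simplicial_boundary (chain_ext H c) = c + chain_ext G c"
      using boundary_chain_ext[of c H "\<lambda>\<tau>. Poly_Mapping.single \<tau> 1 + G \<tau>", OF dH[OF cS]] dc
      by (simp add: chain_ext_plus chain_ext_id)
  next
    fix \<rho> assume "\<rho> \<in> Poly_Mapping.keys (chain_ext G c)"
    then obtain \<tau> where \<tau>: "\<tau> \<in> Poly_Mapping.keys c" "\<rho> \<in> Poly_Mapping.keys (G \<tau>)"
      using keys_chain_ext[of G c] by blast
    then have \<rho>: "\<rho> \<in> \<Psi> \<tau>" "card \<rho> = N" using G[OF cS[OF \<tau>(1)]] c[OF \<tau>(1)] by auto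
    then show "card \<rho> = N" "finite \<rho>" by (auto simp: \<Psi>_def \<Phi>_def)
    have "0 \<le> q * diameter \<tau>" using q S[OF cS[OF \<tau>(1)]] by (simp add: diameter_ge_0)
    then have "diameter \<rho> \<le> q * diameter \<tau>"
      using \<rho> by (intro diameter_le) (auto simp: \<Psi>_def dist_norm)
    then show "\<exists>\<tau>\<in>Poly_Mapping.keys c. \<rho> \<subseteq> convex hull \<tau> \<and>
       diameter \<rho> \<le> real N / real (Suc N) * diameter \<tau>"
      using \<tau> \<rho> by (auto simp: \<Psi>_def \<Phi>_def q_def)
  next
    fix \<rho> assume "\<rho> \<in> Poly_Mapping.keys (chain_ext H c)"
    then obtain \<tau> where \<tau>: "\<tau> \<in> Poly_Mapping.keys c" "\<rho> \<in> Poly_Mapping.keys (H \<tau>)"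
      using keys_chain_ext[of H c] by blast
    then have \<rho>: "\<rho> \<in> \<Phi> \<tau>" "card \<rho> = Suc N" using H[OF cS[OF \<tau>(1)]] c[OF \<tau>(1)] by auto
    with \<tau>(1) show "card \<rho> = Suc N" "finite \<rho>" "\<exists>\<tau>\<in>Poly_Mapping.keys c. \<rho> \<subseteq> convex hull \<tau>"
      by (auto simp: \<Phi>_def)
  qed
qed

text \<open>Each round multiplies the diameter bound by the fixed ratio. The homotopies add up, the
  intermediate cycle \<open>c1\<close> cancelling mod 2, and the supports remain in the original
  hulls because nested hulls compose.\<close>

lemma iterated_subdivision:
  fixes c :: "'e::real_normed_vector set \<Rightarrow>\<^sub>0 bit"
  assumes dc: "simplicial_boundary c = 0"
    and c: "\<forall>\<tau>\<in>Poly_Mapping.keys c. finite \<tau> \<and> card \<tau> = N \<and> diameter \<tau> \<le> D"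
  shows "\<exists>c' h. simplicial_boundary c' = 0 \<and> simplicial_boundary h = c + c' \<and>
    (\<forall>\<rho>\<in>Poly_Mapping.keys c'. finite \<rho> \<and> card \<rho> = N \<and> diameter \<rho> \<le> (real N / real (Suc N)) ^ n * D \<and>
       (\<exists>\<tau>\<in>Poly_Mapping.keys c. \<rho> \<subseteq> convex hull \<tau>)) \<and>
    (\<forall>\<rho>\<in>Poly_Mapping.keys h. finite \<rho> \<and> card \<rho> = Suc N \<and> (\<exists>\<tau>\<in>Poly_Mapping.keys c. \<rho> \<subseteq> convex hull \<tau>))"
proof (induction n)
  case 0
  show ?case by (rule exI[of _ c], rule exI[of _ 0]) (use dc c hull_subset[of _ convex] in auto)
next
  case (Suc n)
  let ?q = "real N / real (Suc N)"
  from Suc.IH obtain c1 h1 where dc1: "simplicial_boundary c1 = 0" and dh1: "simplicial_boundary h1 = c + c1"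
    and c1: "\<forall>\<rho>\<in>Poly_Mapping.keys c1. finite \<rho> \<and> card \<rho> = N \<and> diameter \<rho> \<le> ?q ^ n * D \<and>
       (\<exists>\<tau>\<in>Poly_Mapping.keys c. \<rho> \<subseteq> convex hull \<tau>)"
    and h1: "\<forall>\<rho>\<in>Poly_Mapping.keys h1. finite \<rho> \<and> card \<rho> = Suc N \<and>
       (\<exists>\<tau>\<in>Poly_Mapping.keys c. \<rho> \<subseteq> convex hull \<tau>)"
    by (elim exE conjE)
  have "\<forall>\<rho>\<in>Poly_Mapping.keys c1. finite \<rho> \<and> card \<rho> = N" using c1 by blast
  from subdivision_step[OF dc1 this] obtain c2 h2
    where dc2: "simplicial_boundary c2 = 0" and dh2: "simplicial_boundary h2 = c1 + c2"
    and c2: "\<forall>\<rho>\<in>Poly_Mapping.keys c2. finite \<rho> \<and> card \<rho> = N \<and>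
       (\<exists>\<tau>\<in>Poly_Mapping.keys c1. \<rho> \<subseteq> convex hull \<tau> \<and> diameter \<rho> \<le> ?q * diameter \<tau>)"
    and h2: "\<forall>\<rho>\<in>Poly_Mapping.keys h2. finite \<rho> \<and> card \<rho> = Suc N \<and>
       (\<exists>\<tau>\<in>Poly_Mapping.keys c1. \<rho> \<subseteq> convex hull \<tau>)"
    by (elim exE conjE)
  have trans: "\<exists>\<tau>\<in>Poly_Mapping.keys c. \<rho> \<subseteq> convex hull \<tau>"
    if \<tau>1: "\<tau>1 \<in> Poly_Mapping.keys c1" "\<rho> \<subseteq> convex hull \<tau>1" for \<rho> \<tau>1
  proof -
    obtain \<tau> where \<tau>: "\<tau> \<in> Poly_Mapping.keys c" "\<tau>1 \<subseteq> convex hull \<tau>" using c1 \<tau>1(1) by blast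
    then have "convex hull \<tau>1 \<subseteq> convex hull \<tau>" by (intro hull_minimal) (auto simp: convex_convex_hull)
    with \<tau> \<tau>1 show ?thesis by blast
  qed
  show ?case
  proof (rule exI[of _ c2], rule exI[of _ "h1 + h2"], intro conjI ballI)
    have "c + c1 + (c1 + c2) = c + (c1 + c1) + c2" by (simp only: ac_simps)
    then show "simplicial_boundary (h1 + h2) = c + c2"
      by (simp only: simplicial_boundary_add dh1 dh2 bit_chain_double add_0_right)
  next
    fix \<rho> assume \<rho>: "\<rho> \<in> Poly_Mapping.keys c2"
    then obtain \<tau> where \<tau>: "\<tau> \<in> Poly_Mapping.keys c1" "\<rho> \<subseteq> convex hull \<tau>" "diameter \<rho> \<le> ?q * diameter \<tau>"
      using c2 by blast
    have "?q * diameter \<tau> \<le> ?q * (?q ^ n * D)" by (rule mult_left_mono) (use c1 \<tau>(1) in auto)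
    with \<tau>(3) show "diameter \<rho> \<le> ?q ^ Suc n * D" by (simp add: mult.assoc)
    show "\<exists>\<tau>\<in>Poly_Mapping.keys c. \<rho> \<subseteq> convex hull \<tau>" by (rule trans[OF \<tau>(1,2)])
    show "finite \<rho>" "card \<rho> = N" using c2 \<rho> by auto
  next
    fix \<rho> assume "\<rho> \<in> Poly_Mapping.keys (h1 + h2)"
    then have "\<rho> \<in> Poly_Mapping.keys h1 \<or> \<rho> \<in> Poly_Mapping.keys h2"
      using Poly_Mapping.keys_add[of h1 h2] by blast
    then show "finite \<rho>" "card \<rho> = Suc N" "\<exists>\<tau>\<in>Poly_Mapping.keys c. \<rho> \<subseteq> convex hull \<tau>"
      using h1 h2 trans by blast+
  qed (rule dc2)
qed

lemma fine_subdivision: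
  fixes c :: "'e::real_normed_vector set \<Rightarrow>\<^sub>0 bit"
  assumes dc: "simplicial_boundary c = 0"
    and c: "\<And>\<tau>. \<tau> \<in> Poly_Mapping.keys c \<Longrightarrow> finite \<tau> \<and> card \<tau> = N" and "\<epsilon> > 0"
  obtains c' h where "simplicial_boundary c' = 0" "simplicial_boundary h = c + c'"
    "\<And>\<rho>. \<rho> \<in> Poly_Mapping.keys c' \<Longrightarrow> finite \<rho> \<and> card \<rho> = N \<and> diameter \<rho> \<le> \<epsilon> \<and>
       (\<exists>\<tau>\<in>Poly_Mapping.keys c. \<rho> \<subseteq> convex hull \<tau>)"
    "\<And>\<rho>. \<rho> \<in> Poly_Mapping.keys h \<Longrightarrow> finite \<rho> \<and> card \<rho> = Suc N \<and>
       (\<exists>\<tau>\<in>Poly_Mapping.keys c. \<rho> \<subseteq> convex hull \<tau>)"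
proof -
  \<comment> \<open>The extra element 0 makes the maximum defined when \<open>c\<close> is the zero
    chain.\<close>
  define D where "D = Max (insert 0 (diameter ` Poly_Mapping.keys c))"
  have D: "diameter \<tau> \<le> D" if "\<tau> \<in> Poly_Mapping.keys c" for \<tau>
    unfolding D_def using that by (intro Max_ge) auto
  have "(\<lambda>n. (real N / real (Suc N)) ^ n * D) \<longlonglongrightarrow> 0 * D"
    by (intro tendsto_mult tendsto_const LIMSEQ_realpow_zero) simp_all
  then have "eventually (\<lambda>n. (real N / real (Suc N)) ^ n * D < \<epsilon>) sequentially"
    using \<open>\<epsilon> > 0\<close> by (intro order_tendstoD(2)) auto
  then obtain n where n: "(real N / real (Suc N)) ^ n * D < \<epsilon>"
    using eventually_happens by fastforce
  have "\<forall>\<tau>\<in>Poly_Mapping.keys c. finite \<tau> \<and> card \<tau> = N \<and> diameter \<tau> \<le> D"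
    using c D by simp
  from iterated_subdivision[OF dc this, of n] obtain c' h where
      "simplicial_boundary c' = 0" "simplicial_boundary h = c + c'"
    and c': "\<forall>\<rho>\<in>Poly_Mapping.keys c'. finite \<rho> \<and> card \<rho> = N \<and> diameter \<rho> \<le> (real N / real (Suc N)) ^ n * D \<and>
       (\<exists>\<tau>\<in>Poly_Mapping.keys c. \<rho> \<subseteq> convex hull \<tau>)"
    and h: "\<forall>\<rho>\<in>Poly_Mapping.keys h. finite \<rho> \<and> card \<rho> = Suc N \<and> (\<exists>\<tau>\<in>Poly_Mapping.keys c. \<rho> \<subseteq> convex hull \<tau>)"
    by (elim exE conjE)
  moreover have "finite \<rho> \<and> card \<rho> = N \<and> diameter \<rho> \<le> \<epsilon> \<and> (\<exists>\<tau>\<in>Poly_Mapping.keys c. \<rho> \<subseteq> convex hull \<tau>)"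
    if "\<rho> \<in> Poly_Mapping.keys c'" for \<rho>
    using bspec[OF c' that] n by auto
  ultimately show ?thesis using h by (intro that[of c' h]) auto
qed

section \<open>Mod 2 cycles cover generic points evenly\<close>

text \<open>The weights are indexed by the vertices and not by their images, so that distinct
  vertices with equal images are allowed.\<close>

lemma convex_hull_image_iff:
  fixes ev :: "'a \<Rightarrow> 'e::real_vector"
  assumes "finite \<sigma>"
  shows "p \<in> convex hull (ev ` \<sigma>) \<longleftrightarrow>
    (\<exists>x. (\<forall>v\<in>\<sigma>. 0 \<le> x v) \<and> sum x \<sigma> = 1 \<and> (\<Sum>v\<in>\<sigma>. x v *\<^sub>R ev v) = p)"
proof
  assume "p \<in> convex hull (ev ` \<sigma>)"
  then obtain u where u: "\<And>y. y \<in> ev ` \<sigma> \<Longrightarrow> 0 \<le> u y" "sum u (ev ` \<sigma>) = 1"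
      "(\<Sum>y\<in>ev ` \<sigma>. u y *\<^sub>R y) = p"
    using assms by (auto simp: convex_hull_finite)
  \<comment> \<open>\<open>T\<close> selects one vertex over each image point; it inherits the
    weight of that point and all other vertices get weight 0.\<close>
  obtain T where T: "T \<subseteq> \<sigma>" "inj_on ev T" "ev ` \<sigma> = ev ` T"
    using subset_image_inj[of "ev ` \<sigma>" ev \<sigma>] by auto
  define x where "x v = (if v \<in> T then u (ev v) else 0)" for v
  have "sum x \<sigma> = sum x T"
    by (rule sum.mono_neutral_right) (use assms T in \<open>auto simp: x_def\<close>)
  also have "\<dots> = 1" using u(2) T by (simp add: x_def sum.reindex)
  finally have 1: "sum x \<sigma> = 1" .
  have "(\<Sum>v\<in>\<sigma>. x v *\<^sub>R ev v) = (\<Sum>v\<in>T. x v *\<^sub>R ev v)"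
    by (rule sum.mono_neutral_right) (use assms T in \<open>auto simp: x_def\<close>)
  also have "\<dots> = p" using u(3) T by (simp add: x_def sum.reindex)
  finally show "\<exists>x. (\<forall>v\<in>\<sigma>. 0 \<le> x v) \<and> sum x \<sigma> = 1 \<and> (\<Sum>v\<in>\<sigma>. x v *\<^sub>R ev v) = p"
    using 1 u(1) T by (intro exI[of _ x]) (auto simp: x_def)
next
  assume "\<exists>x. (\<forall>v\<in>\<sigma>. 0 \<le> x v) \<and> sum x \<sigma> = 1 \<and> (\<Sum>v\<in>\<sigma>. x v *\<^sub>R ev v) = p"
  then show "p \<in> convex hull (ev ` \<sigma>)"
    using assms by (auto intro!: convex_sum simp: convex_convex_hull hull_inc)
qed

text \<open>Either the images are distinct and too numerous to be affinely independent in dimension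
  \<open>n\<close>, or two vertices share an image and have the relation with coefficients 1 and
  -1.\<close>

lemma exists_affine_relation:
  fixes ev :: "'a \<Rightarrow> 'e::euclidean_space"
  assumes fin: "finite \<rho>" and card: "card \<rho> \<ge> n + 2" and W: "subspace W" "dim W = n" "ev ` \<rho> \<subseteq> W"
  shows "\<exists>r. sum r \<rho> = 0 \<and> (\<Sum>v\<in>\<rho>. r v *\<^sub>R ev v) = 0 \<and> (\<exists>v\<in>\<rho>. r v \<noteq> 0)"
proof (cases "inj_on ev \<rho>")
  case True
  have "aff_dim (ev ` \<rho>) \<le> int n"
    using aff_dim_subset[OF W(3)] W by (simp add: aff_dim_subspace)
  moreover have "card (ev ` \<rho>) = card \<rho>" using True by (rule card_image)
  ultimately have "affine_dependent (ev ` \<rho>)"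
    using card aff_dim_affine_independent[of "ev ` \<rho>"] by linarith
  then obtain U where "sum U (ev ` \<rho>) = 0" "\<exists>v\<in>ev ` \<rho>. U v \<noteq> 0" "(\<Sum>v\<in>ev ` \<rho>. U v *\<^sub>R v) = 0"
    using fin by (auto simp: affine_dependent_explicit_finite)
  then show ?thesis
    using True by (intro exI[of _ "\<lambda>v. U (ev v)"]) (auto simp: sum.reindex)
next
  case False
  then obtain u w where uw: "u \<in> \<rho>" "w \<in> \<rho>" "u \<noteq> w" "ev u = ev w" by (auto simp: inj_on_def)
  define r where "r v = (if v = u then 1 else if v = w then -1 else (0::real))" for v
  have "\<rho> = insert u (insert w (\<rho> - {u, w}))" using uw by auto
  moreover have "sum r (\<rho> - {u, w}) = 0" "(\<Sum>v\<in>\<rho> - {u, w}. r v *\<^sub>R ev v) = 0"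
    by (auto intro!: sum.neutral simp: r_def)
  ultimately have "sum r \<rho> = r u + r w" "(\<Sum>v\<in>\<rho>. r v *\<^sub>R ev v) = r u *\<^sub>R ev u + r w *\<^sub>R ev w"
    using fin uw(3) by (metis (no_types, lifting) add_0_right finite_Diff finite_insert insertE insertI1
        insertI2 Diff_iff sum.insert)+
  then show ?thesis using uw by (intro exI[of _ r]) (auto simp: r_def)
qed

text \<open>The ways to write \<open>p\<close> as a convex combination of the \<open>n + 2\<close>
  vertices form a polytope \<open>Q\<close>. Facets whose hull contains \<open>p\<close> correspond
  to points of \<open>Q\<close> with a zero coordinate. By genericity such a point has just one zero
  coordinate, and if one exists, \<open>Q\<close> is a segment with exactly two such points, its
  ends. Hence the count is 0 or 2.\<close>

lemma even_card_facets_containing: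
  fixes ev :: "'a \<Rightarrow> 'e::euclidean_space"
  assumes fin: "finite \<rho>" and card: "card \<rho> = n + 2" and W: "subspace W" "dim W = n" "ev ` \<rho> \<subseteq> W"
    and gen: "\<And>\<sigma>. \<sigma> \<subseteq> \<rho> \<Longrightarrow> card \<sigma> \<le> n \<Longrightarrow> p \<notin> convex hull (ev ` \<sigma>)"
  shows "even (card {v\<in>\<rho>. p \<in> convex hull (ev ` (\<rho> - {v}))})"
proof -
  define Q where "Q = {x. (\<forall>v\<in>\<rho>. 0 \<le> x v) \<and> sum x \<rho> = 1 \<and> (\<Sum>v\<in>\<rho>. x v *\<^sub>R ev v) = p}"
  \<comment> \<open>The affine relations among the images: the directions in which points of
    \<open>Q\<close> can move.\<close>
  define R where "R = {r :: 'a \<Rightarrow> real. sum r \<rho> = 0 \<and> (\<Sum>v\<in>\<rho>. r v *\<^sub>R ev v) = 0}"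
  have QI: "p \<in> convex hull (ev ` (\<rho> - T))" if "x \<in> Q" "T \<subseteq> \<rho>" "\<And>v. v \<in> T \<Longrightarrow> x v = 0" for x T
  proof -
    have "sum x (\<rho> - T) = sum x \<rho>" "(\<Sum>v\<in>\<rho> - T. x v *\<^sub>R ev v) = (\<Sum>v\<in>\<rho>. x v *\<^sub>R ev v)"
      by (rule sum.mono_neutral_left; use fin that in auto)+
    then show ?thesis
      using that fin by (subst convex_hull_image_iff) (auto simp: Q_def intro!: exI[of _ x])
  qed
  have QE: "\<exists>x\<in>Q. x v = 0" if v: "v \<in> \<rho>" "p \<in> convex hull (ev ` (\<rho> - {v}))" for v
  proof -
    obtain x where x: "\<forall>w\<in>\<rho> - {v}. 0 \<le> x w" "sum x (\<rho> - {v}) = 1" "(\<Sum>w\<in>\<rho> - {v}. x w *\<^sub>R ev w) = p"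
      using v(2) fin convex_hull_image_iff[of "\<rho> - {v}" p ev] by auto
    have "sum (x(v := 0)) (\<rho> - {v}) = sum x (\<rho> - {v})"
      "(\<Sum>w\<in>\<rho> - {v}. (x(v := 0)) w *\<^sub>R ev w) = (\<Sum>w\<in>\<rho> - {v}. x w *\<^sub>R ev w)"
      by (auto intro!: sum.cong)
    then have "x(v := 0) \<in> Q"
      using x v(1) fin by (auto simp: Q_def sum.remove)
    then show ?thesis by (intro bexI[of _ "x(v := 0)"]) auto
  qed
  \<comment> \<open>Two zero coordinates would put \<open>p\<close> into the hull of only
    \<open>n\<close> vertices.\<close>
  have one_zero: "u = v" if "x \<in> Q" "u \<in> \<rho>" "v \<in> \<rho>" "x u = 0" "x v = 0" for x u v
  proof (rule ccontr)
    assume "u \<noteq> v"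
    then have "card (\<rho> - {u, v}) \<le> n" using that card fin by (simp add: card_Diff_subset)
    moreover have "p \<in> convex hull (ev ` (\<rho> - {u, v}))" by (rule QI[of x]) (use that in auto)
    ultimately show False using gen by blast
  qed
  have move_in: "(\<lambda>v. x v + t * r v) \<in> Q \<longleftrightarrow> (\<forall>v\<in>\<rho>. 0 \<le> x v + t * r v)"
    if "x \<in> Q" "r \<in> R" for x r t
  proof -
    have "(\<Sum>v\<in>\<rho>. (t * r v) *\<^sub>R ev v) = t *\<^sub>R (\<Sum>v\<in>\<rho>. r v *\<^sub>R ev v)"
      by (simp add: scaleR_sum_right)
    moreover have "(\<Sum>v\<in>\<rho>. t * r v) = t * sum r \<rho>" by (simp add: sum_distrib_left)
    ultimately show ?thesis
      using that by (auto simp: Q_def R_def sum.distrib scaleR_add_left)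
  qed
  \<comment> \<open>Ratio test: some coordinate of \<open>r\<close> is negative, as \<open>r\<close>
    is nonzero with sum 0, and the least ratio \<open>x v / (- r v)\<close> over these coordinates
    is the time at which the first coordinate reaches 0.\<close>
  have move: "\<exists>t v. 0 \<le> t \<and> v \<in> \<rho> \<and> r v < 0 \<and> x v + t * r v = 0 \<and> (\<lambda>v. x v + t * r v) \<in> Q"
    if x: "x \<in> Q" and r: "r \<in> R" and nz: "w \<in> \<rho>" "r w \<noteq> 0" for x r w
  proof -
    define N where "N = {v\<in>\<rho>. r v < 0}"
    have "N \<noteq> {}"
    proof
      assume "N = {}"
      then have "\<forall>v\<in>\<rho>. 0 \<le> r v" by (auto simp: N_def not_less)
      then have "\<forall>v\<in>\<rho>. r v = 0" using r fin by (simp add: R_def sum_nonneg_eq_0_iff)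
      with nz show False by simp
    qed
    moreover have "finite N" using fin by (simp add: N_def)
    ultimately obtain v where v: "v \<in> N" "\<And>u. u \<in> N \<Longrightarrow> x v / (- r v) \<le> x u / (- r u)"
      using arg_min_if_finite[of N "\<lambda>v. x v / (- r v)"] by (metis (no_types, lifting) not_less)
    define t where "t = x v / (- r v)"
    have t: "0 \<le> t" using v(1) x by (auto simp: t_def N_def Q_def divide_nonneg_neg)
    have "0 \<le> x u + t * r u" if u: "u \<in> \<rho>" for u
    proof (cases "r u < 0")
      case True
      then have "t \<le> x u / (- r u)" using v(2)[of u] u by (auto simp: t_def N_def)
      with True show ?thesis by (simp add: field_simps)
    next
      case False
      then show ?thesis using t x u by (simp add: Q_def)
    qed
    moreover have "x v + t * r v = 0" using v(1) by (simp add: t_def N_def)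
    ultimately show ?thesis
      using v(1) t move_in[OF x r] by (auto simp: N_def)
  qed
  \<comment> \<open>Moving along a nonzero \<open>r\<close> with \<open>r v = 0\<close> would keep
    coordinate \<open>v\<close> at 0 and bring a second one to 0. So at an end of the segment a
    direction is determined by its coordinate \<open>v\<close>.\<close>
  have unique: "r u = 0" if x: "x \<in> Q" "v \<in> \<rho>" "x v = 0" and r: "r \<in> R" "r v = 0" and u: "u \<in> \<rho>" for x v r u
  proof (rule ccontr)
    assume "r u \<noteq> 0"
    from move[OF x(1) r(1) u this] obtain t w where w: "w \<in> \<rho>" "r w < 0" "x w + t * r w = 0"
      "(\<lambda>v. x v + t * r v) \<in> Q" by blast
    have "w = v" by (rule one_zero[OF w(4)]) (use w x r in auto)
    with w(2) r(2) show False by simp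
  qed
  let ?G = "{v\<in>\<rho>. p \<in> convex hull (ev ` (\<rho> - {v}))}"
  show ?thesis
  proof (cases "?G = {}")
    case False
    then obtain v0 where v0: "v0 \<in> \<rho>" "p \<in> convex hull (ev ` (\<rho> - {v0}))" by blast
    then obtain x where x: "x \<in> Q" "x v0 = 0" using QE by blast
    \<comment> \<open>The sign is chosen so that \<open>r\<close> points from the end
      \<open>x\<close>, where coordinate \<open>v0\<close> is 0, into \<open>Q\<close>; the other
      end is then reached at time \<open>t1\<close>, where coordinate \<open>v1\<close>
      vanishes.\<close>
    obtain r where r: "r \<in> R" "r v0 > 0"
    proof -
      obtain r w where r: "r \<in> R" "w \<in> \<rho>" "r w \<noteq> 0"
        using exists_affine_relation[OF fin _ W] card by (auto simp: R_def)
      then have "r v0 \<noteq> 0" using unique[OF x(1) v0(1) x(2) r(1)] by blast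
      moreover have "(\<lambda>v. - r v) \<in> R" using r(1) by (simp add: R_def sum_negf)
      ultimately show ?thesis using that[of r] that[of "\<lambda>v. - r v"] r(1) by (cases "r v0 > 0") auto
    qed
    have "r v0 \<noteq> 0" using r(2) by simp
    from move[OF x(1) r(1) v0(1) this] obtain t1 v1 where t1: "0 \<le> t1" and v1: "v1 \<in> \<rho>" "r v1 < 0"
      and x1: "x v1 + t1 * r v1 = 0" and y: "(\<lambda>v. x v + t1 * r v) \<in> Q" by blast
    have "?G = {v0, v1}"
    proof (intro equalityI subsetI)
      fix v2 assume "v2 \<in> ?G"
      then have v2: "v2 \<in> \<rho>" "p \<in> convex hull (ev ` (\<rho> - {v2}))" by auto
      then obtain x' where x': "x' \<in> Q" "x' v2 = 0" using QE by blast
      \<comment> \<open>With this \<open>t\<close> the relation \<open>x' - x - t * r\<close>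
        vanishes at \<open>v0\<close>, hence on all of \<open>\<rho>\<close> by
        \<open>unique\<close>: the point \<open>x'\<close> lies on the line through \<open>x\<close>
        in direction \<open>r\<close>.\<close>
      define t where "t = x' v0 / r v0"
      have t: "0 \<le> t" using x'(1) v0(1) r(2) by (simp add: t_def Q_def)
      have "(\<lambda>v. x' v - x v - t * r v) \<in> R"
      proof -
        have "(\<Sum>v\<in>\<rho>. (t * r v) *\<^sub>R ev v) = t *\<^sub>R (\<Sum>v\<in>\<rho>. r v *\<^sub>R ev v)"
          by (simp add: scaleR_sum_right)
        moreover have "(\<Sum>v\<in>\<rho>. t * r v) = t * sum r \<rho>" by (simp add: sum_distrib_left)
        ultimately show ?thesis
          using x(1) x'(1) r(1) by (simp add: Q_def R_def sum_subtractf scaleR_diff_left)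
      qed
      then have "x' v - x v - t * r v = 0" if "v \<in> \<rho>" for v
        by (rule unique[OF x(1) v0(1) x(2)]) (use r(2) x(2) that in \<open>auto simp: t_def\<close>)
      then have eq: "x' v = x v + t * r v" if "v \<in> \<rho>" for v using that by fastforce
      show "v2 \<in> {v0, v1}"
      \<comment> \<open>A third coordinate \<open>v2\<close> is positive at both ends of the
        segment, so it can vanish only after time \<open>t1\<close>; but there coordinate
        \<open>v1\<close> is already negative.\<close>
      proof (rule ccontr)
        assume "v2 \<notin> {v0, v1}"
        then have "x v2 \<noteq> 0" "x v2 + t1 * r v2 \<noteq> 0"
          using one_zero[OF x(1) v2(1) v0(1)] x(2) one_zero[OF y v2(1) v1(1)] x1 by auto
        then have pos: "x v2 > 0" "x v2 + t1 * r v2 > 0"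
          using x(1) y v2(1) by (auto simp: Q_def less_le)
        have z: "x v2 + t * r v2 = 0" using eq[OF v2(1)] x'(2) by simp
        then have neg: "r v2 < 0"
          using pos(1) mult_nonneg_nonneg[OF t, of "r v2"] by linarith
        have "t1 < t"
        proof (rule ccontr)
          assume "\<not> t1 < t"
          then have "t1 * r v2 \<le> t * r v2" using neg by (intro mult_right_mono_neg) auto
          then show False using z pos(2) by linarith
        qed
        then have "t * r v1 < t1 * r v1" using v1(2) by (rule mult_strict_right_mono_neg)
        then have "x' v1 < 0" using eq[OF v1(1)] x1 by simp
        then show False using x'(1) v1(1) by (auto simp: Q_def)
      qed
    next
      fix v assume "v \<in> {v0, v1}"
      moreover have "p \<in> convex hull (ev ` (\<rho> - {v1}))"
        by (rule QI[OF y]) (use v1(1) x1 in auto)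
      ultimately show "v \<in> ?G" using v0 v1(1) by blast
    qed
    moreover have "v0 \<noteq> v1" using r(2) v1(2) by auto
    ultimately show ?thesis by simp
  next
    case True
    then show ?thesis by (simp only: card.empty even_zero)
  qed
qed

text \<open>Counts modulo 2 inside a chain group, where any two equal summands cancel.\<close>

lemma sum_if_parity:
  fixes s :: "'a \<Rightarrow>\<^sub>0 bit"
  assumes "finite A"
  shows "(\<Sum>x\<in>A. if P x then s else 0) = (if even (card {x\<in>A. P x}) then 0 else s)"
  using assms
proof induction
  case (insert a A)
  have "{x \<in> insert a A. P x} = (if P a then insert a {x\<in>A. P x} else {x\<in>A. P x})" by auto
  then show ?case using insert by simp
qed simp

text \<open>As an abstract cycle, \<open>z\<close> bounds its cone, whose simplices have
  \<open>n + 2\<close> vertices. The indicator of covering \<open>p\<close> sums to 0 over the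
  facets of each of them, hence it sums to 0 over \<open>z\<close>.\<close>

lemma even_card_simplices_containing:
  fixes ev :: "'a \<Rightarrow> 'e::euclidean_space"
  assumes dz: "simplicial_boundary z = 0"
    and z: "\<And>\<sigma>. \<sigma> \<in> Poly_Mapping.keys z \<Longrightarrow> finite \<sigma> \<and> card \<sigma> = Suc n \<and> ev ` \<sigma> \<subseteq> W"
    and W: "subspace W" "dim W = n"
    and gen: "\<And>\<sigma>. \<sigma> \<subseteq> \<Union>(Poly_Mapping.keys z) \<Longrightarrow> card \<sigma> \<le> n \<Longrightarrow> p \<notin> convex hull (ev ` \<sigma>)"
  shows "even (card {\<sigma>\<in>Poly_Mapping.keys z. p \<in> convex hull (ev ` \<sigma>)})"
proof (cases "Poly_Mapping.keys z = {}")
  case False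
  then obtain \<sigma>0 where \<sigma>0: "\<sigma>0 \<in> Poly_Mapping.keys z" by blast
  then have "\<sigma>0 \<noteq> {}" using z[OF \<sigma>0] by auto
  \<comment> \<open>The apex is taken among the vertices of \<open>z\<close>, so that the cone stays
    over \<open>W\<close> and the genericity of \<open>p\<close> applies to it.\<close>
  then obtain b where b: "b \<in> \<sigma>0" by blast
  \<comment> \<open>The chains on the empty face serve as a copy of the two-element field, with
    \<open>?s\<close> as its unit; thus the indicator \<open>\<theta>\<close> can be extended by
    \<open>chain_ext\<close>.\<close>
  let ?s = "Poly_Mapping.single {} 1 :: unit set \<Rightarrow>\<^sub>0 bit"
  define \<theta> where "\<theta> \<sigma> = (if p \<in> convex hull (ev ` \<sigma>) then ?s else 0)" for \<sigma>
  let ?u = "cone_chain b z"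
  have u: "simplicial_boundary ?u = z"
  proof -
    have "simplicial_boundary ?u = z + cone_chain b (simplicial_boundary z)"
      by (rule boundary_cone_chain) (simp add: z)
    then show ?thesis by (simp add: dz cone_chain_def)
  qed
  have "chain_ext \<theta> z = chain_ext \<theta> (simplicial_boundary ?u)" by (simp add: u)
  also have "\<dots> = (\<Sum>\<rho>\<in>Poly_Mapping.keys ?u. \<Sum>v\<in>\<rho>. \<theta> (\<rho> - {v}))" by (rule chain_ext_boundary)
  also have "(\<Sum>\<rho>\<in>Poly_Mapping.keys ?u. \<Sum>v\<in>\<rho>. \<theta> (\<rho> - {v})) = 0"
  proof (rule sum.neutral, rule ballI)
    fix \<rho> assume "\<rho> \<in> Poly_Mapping.keys ?u"
    from keys_cone_chain[OF this] obtain \<tau> where \<tau>: "\<tau> \<in> Poly_Mapping.keys z" "b \<notin> \<tau>" "\<rho> = insert b \<tau>"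
      by (elim bexE conjE)
    then have \<rho>: "finite \<rho>" "card \<rho> = n + 2" using z[OF \<tau>(1)] by auto
    have "even (card {v\<in>\<rho>. p \<in> convex hull (ev ` (\<rho> - {v}))})"
    proof (rule even_card_facets_containing[OF \<rho> W])
      show "ev ` \<rho> \<subseteq> W" using z[OF \<tau>(1)] z[OF \<sigma>0] b \<tau>(3) by auto
      show "p \<notin> convex hull (ev ` \<sigma>)" if "\<sigma> \<subseteq> \<rho>" "card \<sigma> \<le> n" for \<sigma>
        by (rule gen) (use that \<sigma>0 b \<tau> in auto)
    qed
    then show "(\<Sum>v\<in>\<rho>. \<theta> (\<rho> - {v})) = 0"
      unfolding \<theta>_def sum_if_parity[OF \<rho>(1)] by (rule if_P)
  qed
  finally have "(if even (card {\<sigma>\<in>Poly_Mapping.keys z. p \<in> convex hull (ev ` \<sigma>)}) then 0 else ?s) = 0"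
    unfolding chain_ext_def \<theta>_def sum_if_parity[OF finite_keys] .
  moreover have "?s \<noteq> 0" by (metis lookup_single_eq lookup_zero zero_neq_one)
  ultimately show ?thesis by (simp split: if_splits)
qed simp

section \<open>Points in general position\<close>

lemma affine_line_unique:
  fixes A :: "'e::real_vector set"
  assumes A: "affine A" and s: "p + s *\<^sub>R d \<in> A" and t: "p + t *\<^sub>R d \<in> A" and "s \<noteq> t"
  shows "p + u *\<^sub>R d \<in> A"
proof -
  define k where "k = (u - t) / (s - t)"
  have "k *\<^sub>R (p + s *\<^sub>R d) + (1 - k) *\<^sub>R (p + t *\<^sub>R d) \<in> A"
    using A s t by (intro mem_affine) auto
  moreover have "k *\<^sub>R (p + s *\<^sub>R d) + (1 - k) *\<^sub>R (p + t *\<^sub>R d) = p + (t + k * (s - t)) *\<^sub>R d"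
    by (simp add: algebra_simps)
  moreover have "t + k * (s - t) = u" using \<open>s \<noteq> t\<close> by (simp add: k_def)
  ultimately show ?thesis by simp
qed

text \<open>Take \<open>p\<close> outside the earlier sets and \<open>q\<close> outside the new one.
  Each affine set misses an end of the segment from \<open>p\<close> to \<open>q\<close>, so it
  contains at most one point of that segment, and finitely many points cannot exhaust it.\<close>

lemma convex_avoids_affine_sets:
  fixes S :: "'e::real_vector set"
  assumes "finite \<A>" "convex S" "S \<noteq> {}" "\<And>A. A \<in> \<A> \<Longrightarrow> affine A \<and> \<not> S \<subseteq> A"
  shows "\<exists>p\<in>S. \<forall>A\<in>\<A>. p \<notin> A"
  using assms(1,4)
proof (induction \<A>)
  case empty
  then show ?case using assms(3) by auto
next
  case (insert B \<A>)
  then obtain p where p: "p \<in> S" "\<forall>A\<in>\<A>. p \<notin> A" by blast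
  obtain q where q: "q \<in> S" "q \<notin> B" using insert.prems[of B] by blast
  define L where "L A = {t :: real. p + t *\<^sub>R (q - p) \<in> A}" for A
  have fin: "finite (L A)" if "A \<in> insert B \<A>" for A
  proof -
    have aff: "affine A" using insert.prems[OF that] by simp
    have "p + 0 *\<^sub>R (q - p) \<notin> A \<or> p + 1 *\<^sub>R (q - p) \<notin> A" using that p q by auto
    then have "s = t" if "s \<in> L A" "t \<in> L A" for s t
      using affine_line_unique[OF aff] that unfolding L_def by blast
    then have "L A = {} \<or> (\<exists>s. L A = {s})" by blast
    then show ?thesis by auto
  qed
  have "infinite {0::real..1}" by (simp add: infinite_Icc)
  moreover have "finite (\<Union>(L ` insert B \<A>))" using fin insert.hyps(1) by blast
  ultimately have "\<not> {0..1} \<subseteq> \<Union>(L ` insert B \<A>)" using finite_subset by blast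
  then obtain t where "t \<in> {0..1}" "t \<notin> \<Union>(L ` insert B \<A>)" by blast
  then have t: "0 \<le> t" "t \<le> 1" "\<forall>A\<in>insert B \<A>. t \<notin> L A" by auto
  have "(1 - t) *\<^sub>R p + t *\<^sub>R q \<in> S" using assms(2) p(1) q(1) t by (simp add: convex_alt)
  moreover have "(1 - t) *\<^sub>R p + t *\<^sub>R q = p + t *\<^sub>R (q - p)" by (simp add: algebra_simps)
  ultimately show ?case using t(3) by (intro bexI[of _ "p + t *\<^sub>R (q - p)"]) (auto simp: L_def)
qed

text \<open>At most \<open>n\<close> points have an affine hull of dimension below \<open>n\<close>,
  while a ball of \<open>W\<close> has dimension \<open>n\<close>; so finitely many such affine
  hulls do not cover the ball.\<close>

lemma generic_point_near_zero:
  fixes ev :: "'a \<Rightarrow> 'e::euclidean_space"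
  assumes P: "finite P" and W: "subspace W" "dim W = n" and "\<epsilon> > 0"
  obtains p where "p \<in> W" "norm p < \<epsilon>"
    "\<And>\<sigma>. \<sigma> \<subseteq> P \<Longrightarrow> card \<sigma> \<le> n \<Longrightarrow> p \<notin> convex hull (ev ` \<sigma>)"
proof -
  define \<A> where "\<A> = (\<lambda>\<sigma>. affine hull (ev ` \<sigma>)) ` {\<sigma>. \<sigma> \<subseteq> P \<and> card \<sigma> \<le> n}"
  let ?S = "W \<inter> ball 0 \<epsilon>"
  have ne: "?S \<noteq> {}" using subspace_0[OF W(1)] \<open>\<epsilon> > 0\<close> by auto
  have cS: "convex ?S" by (intro convex_Int subspace_imp_convex W convex_ball)
  have dS: "aff_dim ?S = int n"
    using aff_dim_convex_Int_open[OF subspace_imp_convex[OF W(1)] open_ball ne] W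
    by (simp add: aff_dim_subspace)
  have "finite {\<sigma>. \<sigma> \<subseteq> P \<and> card \<sigma> \<le> n}" using P by (simp add: finite_subset[of _ "Pow P"])
  then have "finite \<A>" by (simp add: \<A>_def)
  moreover have "affine A \<and> \<not> ?S \<subseteq> A" if "A \<in> \<A>" for A
  proof -
    obtain \<sigma> where \<sigma>: "\<sigma> \<subseteq> P" "card \<sigma> \<le> n" "A = affine hull (ev ` \<sigma>)"
      using \<open>A \<in> \<A>\<close> by (auto simp: \<A>_def)
    have f: "finite \<sigma>" using \<sigma>(1) P finite_subset by blast
    have "aff_dim A \<le> int (card (ev ` \<sigma>)) - 1"
      using aff_dim_le_card[of "ev ` \<sigma>"] f \<sigma>(3) by simp
    also have "\<dots> < int n" using card_image_le[OF f, of ev] \<sigma>(2) by linarith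
    finally have "\<not> ?S \<subseteq> A" using aff_dim_subset[of ?S A] dS by linarith
    then show ?thesis using \<sigma>(3) by (simp add: affine_affine_hull)
  qed
  ultimately have "\<exists>p\<in>?S. \<forall>A\<in>\<A>. p \<notin> A"
    by (intro convex_avoids_affine_sets[OF _ cS ne]) auto
  then obtain p where "p \<in> ?S" "\<forall>A\<in>\<A>. p \<notin> A" by (elim bexE)
  show ?thesis
  proof (rule that)
    show "p \<in> W" "norm p < \<epsilon>" using \<open>p \<in> ?S\<close> by auto
    fix \<sigma> assume "\<sigma> \<subseteq> P" "card \<sigma> \<le> n"
    then have "affine hull (ev ` \<sigma>) \<in> \<A>" by (simp add: \<A>_def)
    then show "p \<notin> convex hull (ev ` \<sigma>)"
      using \<open>\<forall>A\<in>\<A>. p \<notin> A\<close> subsetD[OF convex_hull_subset_affine_hull] by blast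
  qed
qed

section \<open>The colorful face\<close>

text \<open>\<open>B\<close> consists of an orthonormal basis of \<open>W\<close> and the negative
  \<open>- s\<close> of its sum, so its elements add up to 0. For \<open>n = 0\<close> it is the
  single point 0.\<close>

lemma simplex_around_zero:
  fixes W :: "'e::euclidean_space set"
  assumes W: "subspace W" "dim W = n"
  obtains B \<delta> where "finite B" "card B = Suc n" "B \<subseteq> W" "\<delta> > 0"
    "\<And>p. p \<in> W \<Longrightarrow> norm p < \<delta> \<Longrightarrow> p \<in> convex hull B"
    "\<And>b. b \<in> B \<Longrightarrow> 0 \<notin> convex hull (B - {b})"
proof -
  obtain B0 where B0: "B0 \<subseteq> W" "pairwise orthogonal B0" "\<And>w. w \<in> B0 \<Longrightarrow> norm w = 1"
      "independent B0" "card B0 = dim W" "span B0 = W"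
    using orthonormal_basis_subspace[OF W(1)] by blast
  have fin: "finite B0" using B0(4) by (rule independent_imp_finite)
  define s where "s = \<Sum>B0"
  have orth: "x \<bullet> w = 0" if "x \<in> B0" "w \<in> B0" "x \<noteq> w" for x w
    using pairwiseD[OF B0(2) that] by (simp add: orthogonal_def)
  have self: "w \<bullet> w = 1" if "w \<in> B0" for w using B0(3)[OF that] by (simp add: norm_eq_1)
  have s: "s \<bullet> w = 1" if "w \<in> B0" for w
  proof -
    have "s \<bullet> w = w \<bullet> w + (\<Sum>x\<in>B0 - {w}. x \<bullet> w)"
      unfolding s_def inner_sum_left using fin that by (rule sum.remove)
    also have "(\<Sum>x\<in>B0 - {w}. x \<bullet> w) = 0" by (rule sum.neutral) (use orth that in auto)
    finally show ?thesis using self[OF that] by simp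
  qed
  have ss: "s \<bullet> s = real n"
  proof -
    have "s \<bullet> s = (\<Sum>w\<in>B0. s \<bullet> w)" by (subst (2) s_def) (simp add: inner_sum_right)
    then show ?thesis using s B0(5) W(2) by simp
  qed
  have sB: "- s \<notin> B0"
  proof
    assume m: "- s \<in> B0"
    have "s \<bullet> (- s) = 1" by (rule s[OF m])
    then show False using ss by simp
  qed
  let ?B = "insert (- s) B0"
  have hyp: "\<exists>u. \<forall>x\<in>?B - {b}. u \<bullet> x = 1" if b: "b \<in> ?B" for b
  proof (cases "b = - s")
    case True
    then show ?thesis using s by (intro exI[of _ s]) auto
  next
    case False
    with b have b: "b \<in> B0" by simp
    show ?thesis
    \<comment> \<open>This vector has inner product 1 with the basis vectors other than
      \<open>b\<close>, and with \<open>- s\<close> it gives \<open>- n + (n + 1) = 1\<close>; so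
      the facet opposite \<open>b\<close> lies in a hyperplane missing the origin.\<close>
    proof (intro exI[of _ "s - (real n + 1) *\<^sub>R b"] ballI)
      fix x assume "x \<in> ?B - {b}"
      then show "(s - (real n + 1) *\<^sub>R b) \<bullet> x = 1"
        using s[of x] orth[OF b, of x] ss s[OF b] by (auto simp: inner_diff_left inner_diff_right inner_commute)
    qed
  qed
  \<comment> \<open>The solution of \<open>(1 - n * \<delta>) / (n + 1) = \<delta>\<close>; it
    ensures that the shift \<open>t\<close> below outweighs every coordinate of
    \<open>p\<close>.\<close>
  define \<delta> where "\<delta> = 1 / (2 * real n + 1)"
  have \<delta>: "\<delta> > 0" by (simp add: \<delta>_def add_nonneg_pos)
  have near: "p \<in> convex hull ?B" if p: "p \<in> W" "norm p < \<delta>" for p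
  proof -
    \<comment> \<open>Adding \<open>t\<close> times the zero sum of \<open>B\<close> to the
      orthonormal expansion of \<open>p\<close> does not change the point; this \<open>t\<close>
      makes the weights sum to 1.\<close>
    define t where "t = (1 - (\<Sum>w\<in>B0. p \<bullet> w)) / (real n + 1)"
    have abs: "\<bar>p \<bullet> w\<bar> \<le> \<delta>" if "w \<in> B0" for w
      using Cauchy_Schwarz_ineq2[of p w] B0(3)[OF that] p(2) by simp
    have "(\<Sum>w\<in>B0. p \<bullet> w) \<le> (\<Sum>w\<in>B0. \<delta>)" by (rule sum_mono) (use abs in force)
    then have "(\<Sum>w\<in>B0. p \<bullet> w) \<le> real n * \<delta>" using B0(5) W(2) by simp
    then have "(1 - real n * \<delta>) / (real n + 1) \<le> t" unfolding t_def by (intro divide_right_mono) auto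
    moreover have "(1 - real n * \<delta>) / (real n + 1) = \<delta>"
    proof -
      have "2 * real n + 1 \<noteq> 0" "real n + 1 \<noteq> 0" by (auto simp: add_nonneg_eq_0_iff)
      then show ?thesis by (simp add: \<delta>_def divide_simps)
    qed
    ultimately have t: "\<delta> \<le> t" by simp
    define x where "x w = (if w = - s then t else p \<bullet> w + t)" for w
    have xB: "x w = p \<bullet> w + t" if "w \<in> B0" for w using that sB by (auto simp: x_def)
    have "sum x ?B = t + (\<Sum>w\<in>B0. p \<bullet> w + t)"
      using fin sB xB by (simp add: x_def[of "- s"])
    also have "\<dots> = (\<Sum>w\<in>B0. p \<bullet> w) + t * (real n + 1)"
      using B0(5) W(2) by (simp add: sum.distrib algebra_simps)
    also have "\<dots> = 1" unfolding t_def by (simp add: add_nonneg_eq_0_iff)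
    finally have 1: "sum x ?B = 1" .
    have "(\<Sum>w\<in>?B. x w *\<^sub>R w) = t *\<^sub>R (- s) + (\<Sum>w\<in>B0. (p \<bullet> w + t) *\<^sub>R w)"
      using fin sB xB by (simp add: x_def[of "- s"])
    also have "\<dots> = (\<Sum>w\<in>B0. (p \<bullet> w) *\<^sub>R w)"
      by (simp add: scaleR_add_left sum.distrib s_def scaleR_sum_right)
    also have "\<dots> = p"
      by (rule orthonormal_basis_expand[OF B0(2,3) _ fin]) (use p B0(6) in auto)
    finally have 2: "(\<Sum>w\<in>?B. x w *\<^sub>R w) = p" .
    have "\<forall>w\<in>?B. 0 \<le> x w"
    proof
      fix w assume "w \<in> ?B"
      then show "0 \<le> x w" using abs[of w] t \<delta> xB[of w] by (cases "w = - s") (auto simp: x_def[of "- s"])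
    qed
    with 1 2 show ?thesis using fin by (auto simp: convex_hull_finite)
  qed
  show ?thesis
  proof (rule that[OF _ _ _ \<delta> near])
    show "finite ?B" "card ?B = Suc n" using fin sB B0(5) W(2) by auto
    show "?B \<subseteq> W"
      using B0(1) W(1) by (simp add: s_def subspace_neg subspace_sum subset_iff)
    fix b assume "b \<in> ?B"
    then obtain u where u: "\<forall>x\<in>?B - {b}. u \<bullet> x = 1" using hyp by blast
    then have "convex hull (?B - {b}) \<subseteq> {x. u \<bullet> x = 1}"
      by (intro hull_minimal) (auto simp: convex_hyperplane)
    then show "0 \<notin> convex hull (?B - {b})" by auto
  qed
qed

section \<open>Keeping simplices away from the origin\<close>

lemma closed_avoiding_zero_norm_bounded_below:
  fixes C :: "'e::euclidean_space set"
  assumes "closed C" "0 \<notin> C"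
  obtains r where "r > 0" "\<And>x. x \<in> C \<Longrightarrow> r \<le> norm x"
proof -
  have "open (- C)" "0 \<in> - C" using assms by auto
  then obtain r where r: "r > 0" "ball 0 r \<subseteq> - C" by (auto elim: openE)
  have "r \<le> norm x" if "x \<in> C" for x
  proof (rule ccontr)
    assume "\<not> r \<le> norm x"
    then have "x \<in> ball 0 r" by simp
    with r(2) that show False by blast
  qed
  with r(1) show ?thesis by (rule that)
qed

lemma closed_union_hulls:
  fixes f :: "'a \<Rightarrow> 'e::euclidean_space set"
  assumes "finite A" "\<And>x. x \<in> A \<Longrightarrow> finite (f x)"
  shows "closed (\<Union>x\<in>A. convex hull (f x))"
  using assms by (intro closed_UN ballI compact_imp_closed finite_imp_compact_convex_hull)

text \<open>The open \<open>r\<close>-neighbourhood of the hull of \<open>insert y P\<close> is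
  convex and contains both \<open>P\<close> and the ball. If it contained 0, the hull would have a
  point of norm below \<open>r\<close>.\<close>

lemma hull_union_ball_avoids_zero:
  fixes y :: "'e::euclidean_space"
  assumes r: "r > 0" "\<And>x. x \<in> convex hull (insert y P) \<Longrightarrow> r \<le> norm x"
  shows "0 \<notin> convex hull (P \<union> ball y r)"
proof
  define N where "N = (\<Union>x\<in>convex hull (insert y P). \<Union>z\<in>ball 0 r. {x + z})"
  have "convex N" unfolding N_def by (intro convex_sums convex_convex_hull convex_ball)
  moreover have "P \<union> ball y r \<subseteq> N"
  proof
    fix x assume "x \<in> P \<union> ball y r"
    then show "x \<in> N"
    proof (rule UnE)
      assume "x \<in> P"
      then have "x \<in> convex hull (insert y P)" by (simp add: hull_inc)
      moreover have "0 \<in> ball (0::'e) r" "x = x + 0" using r(1) by simp_all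
      ultimately show ?thesis unfolding N_def by blast
    next
      assume "x \<in> ball y r"
      then have "x - y \<in> ball 0 r" by (simp add: dist_norm norm_minus_commute)
      moreover have "y \<in> convex hull (insert y P)" by (simp add: hull_inc)
      moreover have "x = y + (x - y)" by simp
      ultimately show ?thesis unfolding N_def by blast
    qed
  qed
  ultimately have "convex hull (P \<union> ball y r) \<subseteq> N" by (rule hull_minimal[rotated])
  moreover assume "0 \<in> convex hull (P \<union> ball y r)"
  ultimately have "0 \<in> N" by blast
  then obtain x z where xz: "x \<in> convex hull (insert y P)" "norm z < r" "x + z = 0"
    by (auto simp: N_def)
  then have "norm x = norm z" by (metis add_eq_0_iff norm_minus_cancel)
  with r(2)[OF xz(1)] xz(2) show False by simp
qed

text \<open>In a convex combination equal to 0, pairing with \<open>y\<close> gives nonnegative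
  terms with sum 0. The weight of \<open>y\<close> is therefore 0, and 0 already lies in the hull of
  \<open>P\<close>.\<close>

lemma zero_not_in_hull_insert:
  fixes y :: "'e::euclidean_space"
  assumes "y \<noteq> 0" "\<And>x. x \<in> P \<Longrightarrow> 0 \<le> y \<bullet> x" "0 \<notin> convex hull P"
  shows "0 \<notin> convex hull (insert y P)"
proof (cases "P = {}")
  case False
  show ?thesis
  proof
    assume "0 \<in> convex hull (insert y P)"
    then obtain u v x where x: "0 \<le> u" "0 \<le> v" "u + v = 1" "x \<in> convex hull P"
        "0 = u *\<^sub>R y + v *\<^sub>R x"
      using False by (auto simp: convex_hull_insert)
    have "convex hull P \<subseteq> {x. 0 \<le> y \<bullet> x}"
      by (rule hull_minimal) (use assms(2) convex_halfspace_ge[of 0 y] in auto)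
    then have "0 \<le> y \<bullet> x" using x(4) by blast
    then have "0 \<le> v * (y \<bullet> x)" using x(2) by simp
    moreover have "u * (y \<bullet> y) + v * (y \<bullet> x) = 0"
      using arg_cong[OF x(5), of "\<lambda>z. y \<bullet> z"] by (simp add: inner_add_right)
    moreover have "0 < y \<bullet> y" using assms(1) by simp
    ultimately have "u = 0" using x(1) by (metis add_nonneg_eq_0_iff less_imp_le mult_eq_0_iff
          mult_nonneg_nonneg less_irrefl)
    with x assms(3) show False by simp
  qed
qed (use assms(1) in simp)

text \<open>Makes the half-space argument at \<open>y\<close> stable under perturbation. Both
  requirements are finitely many open conditions on the radius, and the minimum of the two radii is
  taken.\<close>

lemma separating_ball:
  fixes a :: "'v \<Rightarrow> 'e::euclidean_space"
  assumes X: "finite X" and J: "\<And>\<sigma>. \<sigma> \<in> J \<Longrightarrow> \<sigma> \<subseteq> X" "\<And>\<sigma>. \<sigma> \<in> J \<Longrightarrow> 0 \<notin> convex hull (a ` \<sigma>)" and "y \<noteq> 0"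
  shows "\<exists>r>0. (\<forall>y'\<in>ball y r. \<forall>v\<in>X. 0 \<le> y' \<bullet> a v \<longrightarrow> 0 \<le> y \<bullet> a v) \<and>
    (\<forall>\<sigma>\<in>J. (\<forall>v\<in>\<sigma>. 0 \<le> y \<bullet> a v) \<longrightarrow> 0 \<notin> convex hull (a ` \<sigma> \<union> ball y r))"
proof -
  \<comment> \<open>Vertices strictly on the negative side of \<open>y\<close> stay there for all
    nearby points; the first claim is the contrapositive.\<close>
  define O1 where "O1 = (\<Inter>v\<in>{v\<in>X. y \<bullet> a v < 0}. {y'. a v \<bullet> y' < 0})"
  have "open O1" unfolding O1_def using X by (intro open_INT) (auto simp: open_halfspace_lt)
  moreover have "y \<in> O1" by (simp add: O1_def inner_commute)
  ultimately obtain r1 where r1: "r1 > 0" "ball y r1 \<subseteq> O1" by (auto elim: openE)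
  define J' where "J' = {\<sigma>\<in>J. \<forall>v\<in>\<sigma>. 0 \<le> y \<bullet> a v}"
  define C where "C = (\<Union>\<sigma>\<in>J'. convex hull (insert y (a ` \<sigma>)))"
  have "J' \<subseteq> Pow X" using J(1) by (auto simp: J'_def)
  then have fJ: "finite J'" using X by (simp add: finite_subset)
  have "finite \<sigma>" if "\<sigma> \<in> J'" for \<sigma>
    by (rule finite_subset[OF _ X]) (use J(1) that in \<open>simp add: J'_def\<close>)
  then have "closed C" unfolding C_def by (intro closed_union_hulls[OF fJ]) simp
  moreover have "0 \<notin> C"
  proof
    assume "0 \<in> C"
    then obtain \<sigma> where \<sigma>: "\<sigma> \<in> J'" "0 \<in> convex hull (insert y (a ` \<sigma>))" by (auto simp: C_def)
    have "0 \<notin> convex hull (insert y (a ` \<sigma>))"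
      by (rule zero_not_in_hull_insert[OF \<open>y \<noteq> 0\<close>]) (use \<sigma>(1) J(2) in \<open>auto simp: J'_def\<close>)
    with \<sigma>(2) show False by simp
  qed
  ultimately obtain r2 where r2: "r2 > 0" "\<And>x. x \<in> C \<Longrightarrow> r2 \<le> norm x"
    using closed_avoiding_zero_norm_bounded_below by blast
  show ?thesis
  proof (intro exI[of _ "min r1 r2"] conjI ballI impI)
    show "min r1 r2 > 0" using r1 r2 by simp
    show "0 \<le> y \<bullet> a v" if that: "y' \<in> ball y (min r1 r2)" "v \<in> X" "0 \<le> y' \<bullet> a v" for y' v
    proof (rule ccontr)
      assume "\<not> 0 \<le> y \<bullet> a v"
      moreover have "y' \<in> O1" using that(1) r1(2) by auto
      ultimately show False using that(2,3) by (auto simp: O1_def inner_commute)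
    qed
    fix \<sigma> assume \<sigma>: "\<sigma> \<in> J" "\<forall>v\<in>\<sigma>. 0 \<le> y \<bullet> a v"
    have "0 \<notin> convex hull (a ` \<sigma> \<union> ball y r2)"
      by (rule hull_union_ball_avoids_zero[OF r2(1)], rule r2(2)) (use \<sigma> in \<open>auto simp: C_def J'_def\<close>)
    moreover have "convex hull (a ` \<sigma> \<union> ball y (min r1 r2)) \<subseteq> convex hull (a ` \<sigma> \<union> ball y r2)"
      by (rule hull_mono) auto
    ultimately show "0 \<notin> convex hull (a ` \<sigma> \<union> ball y (min r1 r2))" by blast
  qed
qed

text \<open>Otherwise the positive relation in each class forces every
  \<open>y \<bullet> a v\<close> to be 0, so \<open>y\<close> is orthogonal to the span that
  contains it. This makes the vertex sets on which the half-space condition holds proper.\<close>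

lemma exists_negative_vertex:
  fixes a :: "'v \<Rightarrow> 'e::euclidean_space"
  assumes X: "X = (\<Union>i\<in>I. V i)" "finite X"
    and pos: "\<And>i. i \<in> I \<Longrightarrow> \<exists>l. (\<forall>v\<in>V i. 0 < l v) \<and> (\<Sum>v\<in>V i. l v *\<^sub>R a v) = 0"
    and y: "y \<in> span (a ` X)" "y \<noteq> 0"
  shows "\<exists>v\<in>X. y \<bullet> a v < 0"
proof (rule ccontr)
  assume "\<not> ?thesis"
  then have nn: "\<And>v. v \<in> X \<Longrightarrow> 0 \<le> y \<bullet> a v" by fastforce
  have zero: "y \<bullet> a v = 0" if vX: "v \<in> X" for v
  proof -
    obtain i where i: "i \<in> I" "v \<in> V i" using vX X(1) by blast
    then obtain l where l: "\<forall>v\<in>V i. 0 < l v" "(\<Sum>v\<in>V i. l v *\<^sub>R a v) = 0" using pos by blast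
    have fin: "finite (V i)" using X i(1) by (auto intro: finite_subset)
    have "(\<Sum>w\<in>V i. l w * (y \<bullet> a w)) = y \<bullet> (\<Sum>w\<in>V i. l w *\<^sub>R a w)"
      by (simp add: inner_sum_right)
    then have "(\<Sum>w\<in>V i. l w * (y \<bullet> a w)) = 0" using l(2) by simp
    moreover have "\<forall>w\<in>V i. 0 \<le> l w * (y \<bullet> a w)"
    proof
      fix w assume w: "w \<in> V i"
      then have "0 \<le> y \<bullet> a w" using nn i(1) X(1) by blast
      with l(1) w show "0 \<le> l w * (y \<bullet> a w)" by (simp add: less_imp_le)
    qed
    ultimately have "l v * (y \<bullet> a v) = 0" using fin i(2) by (simp add: sum_nonneg_eq_0_iff)
    then show ?thesis using l(1) i(2) by (metis less_irrefl mult_eq_0_iff)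
  qed
  have "orthogonal y y"
    by (rule orthogonal_to_span[OF y(1)]) (use zero in \<open>auto simp: orthogonal_def\<close>)
  then show False using y(2) by (simp add: orthogonal_def)
qed

text \<open>Otherwise a combination of negative numbers with positive weights would be 0. This makes
  the half-space vertex sets meet every class.\<close>

lemma exists_nonneg_vertex:
  fixes a :: "'v \<Rightarrow> 'e::euclidean_space"
  assumes "finite S" "S \<noteq> {}" "\<forall>v\<in>S. 0 < l v" "(\<Sum>v\<in>S. l v *\<^sub>R a v) = 0"
  shows "\<exists>v\<in>S. 0 \<le> y \<bullet> a v"
proof (rule ccontr)
  assume "\<not> ?thesis"
  then have "(\<Sum>v\<in>S. l v * (y \<bullet> a v)) < (\<Sum>v\<in>S. 0)"
    using assms by (intro sum_strict_mono) (auto simp: mult_pos_neg not_le)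
  moreover have "(\<Sum>v\<in>S. l v * (y \<bullet> a v)) = y \<bullet> (\<Sum>v\<in>S. l v *\<^sub>R a v)"
    by (simp add: inner_sum_right)
  ultimately show False using assms(4) by simp
qed

text \<open>The linear form of the theorem: the map is given by its vertex images, in any Euclidean
  space where they span at most \<open>d\<close> dimensions, and closed hulls stand in for open
  simplices.\<close>

lemma colorful_face_containing_zero:
  fixes a :: "'v \<Rightarrow> 'e::euclidean_space"
  assumes X: "X = (\<Union>i\<in>I. V i)" "finite X"
    and J: "simplicial_complex_on X J"
    and conn: "homologically_connected (int d - 1) J"
    and sub: "\<And>U. U \<subset> X \<Longrightarrow> \<forall>i\<in>I. U \<inter> V i \<noteq> {} \<Longrightarrow>
      homologically_connected (int d - 2) (induced_subcomplex J U)"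
    and ne: "\<And>i. i \<in> I \<Longrightarrow> V i \<noteq> {}"
    and pos: "\<And>i. i \<in> I \<Longrightarrow> \<exists>l. (\<forall>v\<in>V i. 0 < l v) \<and> (\<Sum>v\<in>V i. l v *\<^sub>R a v) = 0"
    and dim: "dim (span (a ` X)) \<le> d"
  shows "\<exists>\<sigma>\<in>J. 0 \<in> convex hull (a ` \<sigma>)"
proof (rule ccontr)
  assume "\<not> ?thesis"
  then have J0: "\<And>\<sigma>. \<sigma> \<in> J \<Longrightarrow> 0 \<notin> convex hull (a ` \<sigma>)" by blast
  have Jf: "finite \<sigma>" "\<sigma> \<subseteq> X" if "\<sigma> \<in> J" for \<sigma> using J that by (auto simp: simplicial_complex_on_def)
  let ?L = "Inl :: 'v \<Rightarrow> 'v + 'e" and ?R = "Inr :: 'e \<Rightarrow> 'v + 'e"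
  define W where "W = span (a ` X)"
  define n where "n = dim W"
  have W: "subspace W" "dim W = n" and nd: "n \<le> d" and aW: "\<And>v. v \<in> X \<Longrightarrow> a v \<in> W"
    using dim by (auto simp: W_def n_def subspace_span span_base)
  obtain B \<delta> where B: "finite B" "card B = Suc n" "B \<subseteq> W" "\<delta> > 0"
    "\<And>p. p \<in> W \<Longrightarrow> norm p < \<delta> \<Longrightarrow> p \<in> convex hull B"
    "\<And>b. b \<in> B \<Longrightarrow> 0 \<notin> convex hull (B - {b})"
    using simplex_around_zero[OF W] by blast
  \<comment> \<open>The boundary of the simplex around the origin; it is compact, misses 0, and is
    empty for \<open>n = 0\<close>.\<close>
  define F where "F = (\<Union>b\<in>B. convex hull (B - {b}))"
  have F0: "0 \<notin> F" using B(6) by (auto simp: F_def)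
  have FW: "F \<subseteq> W"
  proof -
    have "convex hull (B - {b}) \<subseteq> W" for b
      by (rule hull_minimal) (use B(3) W(1) in \<open>auto simp: subspace_imp_convex\<close>)
    then show ?thesis by (auto simp: F_def)
  qed
  have Fc: "compact F" unfolding F_def
    by (intro compact_UN B(1) finite_imp_compact_convex_hull) (use B(1) in auto)

  define good where "good y r \<longleftrightarrow> r > 0 \<and>
      (\<forall>y'\<in>ball y r. \<forall>v\<in>X. 0 \<le> y' \<bullet> a v \<longrightarrow> 0 \<le> y \<bullet> a v) \<and>
      (\<forall>\<sigma>\<in>J. (\<forall>v\<in>\<sigma>. 0 \<le> y \<bullet> a v) \<longrightarrow> 0 \<notin> convex hull (a ` \<sigma> \<union> ball y r))" for y r
  have "\<exists>r. good y r" if y: "y \<in> F" for y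
  proof -
    have "y \<noteq> 0" using y F0 by blast
    from separating_ball[OF X(2) Jf(2) J0 this] show ?thesis unfolding good_def .
  qed
  then obtain R where R: "\<And>y. y \<in> F \<Longrightarrow> good y (R y)" by metis
  define O' where "O' y = ball y (R y)" for y
  have Osub: "0 \<le> y \<bullet> a v" if "y \<in> F" "y' \<in> O' y" "v \<in> X" "0 \<le> y' \<bullet> a v" for y y' v
    using R[OF that(1)] that(2-4) unfolding good_def O'_def by blast
  have O0: "0 \<notin> convex hull (a ` \<sigma> \<union> O' y)" if "y \<in> F" "\<sigma> \<in> J" "\<forall>v\<in>\<sigma>. 0 \<le> y \<bullet> a v" for y \<sigma>
    using R[OF that(1)] that(2,3) unfolding good_def O'_def by blast
  \<comment> \<open>The set \<open>{}\<close> is added so that the cover is a nonempty family even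
    if \<open>F\<close> is empty.\<close>
  have cover: "F \<subseteq> \<Union>(insert {} (O' ` F))"
  proof
    fix y assume "y \<in> F"
    moreover from R[OF this] have "y \<in> O' y" by (simp add: O'_def good_def)
    ultimately show "y \<in> \<Union>(insert {} (O' ` F))" by blast
  qed
  obtain L where L: "L > 0" "\<And>T. T \<subseteq> F \<Longrightarrow> diameter T < L \<Longrightarrow> \<exists>C\<in>insert {} (O' ` F). T \<subseteq> C"
    by (rule Lebesgue_number_lemma[OF Fc _ cover]) (auto simp: O'_def)

  \<comment> \<open>simplices so small that one \<open>y\<close> governs all their points\<close>
  define S where "S = {\<tau>. finite \<tau> \<and> \<tau> \<subseteq> F \<and> (\<tau> = {} \<or> (\<exists>y\<in>F. \<tau> \<subseteq> O' y))}"
  \<comment> \<open>The union over all points of \<open>\<tau>\<close> makes the carrier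
    \<open>\<Phi>\<close> monotone in \<open>\<tau>\<close>, while \<open>Osub\<close> still places
    it in the half-space of the one \<open>y\<close> that governs \<open>\<tau>\<close>.\<close>
  define U where "U \<tau> = {v\<in>X. \<exists>y\<in>\<tau>. 0 \<le> y \<bullet> a v}" for \<tau>
  define \<Phi> where "\<Phi> \<tau> = induced_subcomplex J (U \<tau>)" for \<tau>
  have S: "finite \<tau>" "\<tau> \<subseteq> F" "\<And>v. \<tau> - {v} \<in> S" if "\<tau> \<in> S" for \<tau>
    using that by (auto simp: S_def)
  have \<Phi>: "\<sigma> \<in> J \<and> \<sigma> \<subseteq> U \<tau>" if "\<sigma> \<in> \<Phi> \<tau>" for \<sigma> \<tau>
    using that by (simp add: \<Phi>_def induced_subcomplex_def)
  have \<Phi>_mono: "\<Phi> (\<tau> - {v}) \<subseteq> \<Phi> \<tau>" for \<tau> v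
    by (auto simp: \<Phi>_def induced_subcomplex_def U_def)
  have complex_sub: "simplicial_complex_on X (\<Phi> \<tau>)" for \<tau>
    using J by (auto simp: \<Phi>_def induced_subcomplex_def simplicial_complex_on_def)
  have empty: "{} \<in> \<Phi> \<tau>" for \<tau> using complex_sub[of \<tau>] by (simp add: simplicial_complex_on_def)
  have conn_sub: "homologically_connected (int d - 2) (\<Phi> \<tau>)" if \<tau>: "\<tau> \<in> S" "\<tau> \<noteq> {}" for \<tau>
    unfolding \<Phi>_def
  proof (rule sub)
    obtain y where y: "y \<in> F" "\<tau> \<subseteq> O' y" using \<tau> by (auto simp: S_def)
    have "y \<noteq> 0" using y(1) F0 by blast
    moreover have "y \<in> span (a ` X)" using y(1) FW by (auto simp: W_def)
    ultimately obtain v where v: "v \<in> X" "y \<bullet> a v < 0"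
      using exists_negative_vertex[OF X pos] by blast
    \<comment> \<open>By \<open>Osub\<close>, a vertex negative for the governing \<open>y\<close>
      is negative for every point of \<open>\<tau>\<close>.\<close>
    then have "v \<notin> U \<tau>" using Osub[OF y(1), of _ v] y(2) by (fastforce simp: U_def)
    with v(1) show "U \<tau> \<subset> X" by (auto simp: U_def)
    show "\<forall>i\<in>I. U \<tau> \<inter> V i \<noteq> {}"
    proof
      fix i assume i: "i \<in> I"
      obtain l where l: "\<forall>v\<in>V i. 0 < l v" "(\<Sum>v\<in>V i. l v *\<^sub>R a v) = 0" using pos[OF i] by blast
      have Vi: "V i \<subseteq> X" using X(1) i by blast
      obtain y where y: "y \<in> \<tau>" using \<tau>(2) by blast
      obtain v where "v \<in> V i" "0 \<le> y \<bullet> a v"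
        using exists_nonneg_vertex[OF finite_subset[OF Vi X(2)] ne[OF i] l] by blast
      then have "v \<in> U \<tau> \<inter> V i" using y Vi by (auto simp: U_def)
      then show "U \<tau> \<inter> V i \<noteq> {}" by blast
    qed
  qed

  \<comment> \<open>The chain map into \<open>J\<close>. For \<open>\<tau>\<close> with
    \<open>k \<le> n\<close> points it requires the filling of \<open>(k - 2)\<close>-cycles, and
    \<open>k - 2 \<le> d - 2\<close>.\<close>
  have "\<exists>f. f {} = Poly_Mapping.single {} 1 \<and> (\<forall>\<tau>\<in>S. card \<tau> \<le> n \<longrightarrow>
      Poly_Mapping.keys (f \<tau>) \<subseteq> {\<sigma>\<in>\<Phi> \<tau>. card \<sigma> = card \<tau> + 0} \<and>
      simplicial_boundary (f \<tau>) = 0 + (\<Sum>v\<in>\<tau>. f (\<tau> - {v})))"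
  proof (rule carrier_chain_map)
    show "\<Phi> (\<tau> - {v}) \<subseteq> \<Phi> \<tau>" for \<tau> v by (rule \<Phi>_mono)
    fix \<tau> z
    assume \<tau>: "\<tau> \<in> S" "\<tau> \<noteq> {}" "card \<tau> \<le> n" and z: "simplicial_boundary z = 0"
        "Poly_Mapping.keys z \<subseteq> {\<sigma> \<in> \<Phi> \<tau>. Suc (card \<sigma>) = card \<tau> + 0}"
    have c: "Suc (card \<tau> - 1) = card \<tau>" using \<tau>(2) S(1)[OF \<tau>(1)] by (simp add: card_gt_0_iff)
    have "int (card \<tau> - 1) - 1 \<le> int d - 2" using c \<tau>(3) nd by linarith
    then have "\<exists>u. Poly_Mapping.keys u \<subseteq> {\<sigma> \<in> \<Phi> \<tau>. card \<sigma> = Suc (card \<tau> - 1)} \<and> simplicial_boundary u = z"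
      by (rule homologically_connected_cycle_bounds[OF complex_sub conn_sub[OF \<tau>(1,2)] _ z(1)])
        (use z(2) in auto)
    then show "\<exists>u. Poly_Mapping.keys u \<subseteq> {\<sigma> \<in> \<Phi> \<tau>. card \<sigma> = card \<tau> + 0} \<and> simplicial_boundary u = z"
      by (simp only: c add_0_right)
  qed (simp_all add: S simplicial_boundary_single empty)
  then obtain f where f0: "f {} = Poly_Mapping.single {} 1"
    and f: "\<forall>\<tau>\<in>S. card \<tau> \<le> n \<longrightarrow> Poly_Mapping.keys (f \<tau>) \<subseteq> {\<sigma>\<in>\<Phi> \<tau>. card \<sigma> = card \<tau> + 0} \<and>
      simplicial_boundary (f \<tau>) = 0 + (\<Sum>v\<in>\<tau>. f (\<tau> - {v}))"
    by (elim exE conjE)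

  define S' where "S' = {\<tau>\<in>S. card \<tau> \<le> n}"
  have S'I: "\<tau> - {v} \<in> S'" if "\<tau> \<in> S'" for \<tau> v
    using that S(3)[of \<tau> v] card_Diff1_le[of \<tau> v] by (auto simp: S'_def)
  have S': "finite \<tau>" "\<tau> \<in> S" "card \<tau> \<le> n" if "\<tau> \<in> S'" for \<tau> using that S(1) by (auto simp: S'_def)
  have fk: "\<sigma> \<in> \<Phi> \<tau> \<and> card \<sigma> = card \<tau>" if "\<tau> \<in> S'" "\<sigma> \<in> Poly_Mapping.keys (f \<tau>)" for \<tau> \<sigma>
    using f that by (auto simp: S'_def)
  have df: "simplicial_boundary (f \<tau>) = 0 + (\<Sum>v\<in>\<tau>. f (\<tau> - {v}))" if "\<tau> \<in> S'" for \<tau>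
    using f that by (simp add: S'_def)

  \<comment> \<open>The tags \<open>Inl\<close> and \<open>Inr\<close> keep vertices apart whose images coincide.\<close>
  define \<Psi> :: "'e set \<Rightarrow> ('v + 'e) set set" where
    "\<Psi> \<tau> = {\<rho>. finite \<rho> \<and> (\<exists>\<tau>'\<subseteq>\<tau>. \<exists>\<sigma>\<in>\<Phi> \<tau>. \<rho> = ?L ` \<sigma> \<union> ?R ` \<tau>')}" for \<tau>
  have \<Psi>_mono: "\<Psi> (\<tau> - {v}) \<subseteq> \<Psi> \<tau>" for \<tau> v
    using \<Phi>_mono[of \<tau> v] unfolding \<Psi>_def by blast
  define g :: "'e set \<Rightarrow> ('v + 'e) set \<Rightarrow>\<^sub>0 bit" where
    "g \<tau> = Poly_Mapping.single (?R ` \<tau>) 1 + push_chain ?L (f \<tau>)" for \<tau>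
  \<comment> \<open>The chain homotopy between the inclusion and \<open>f\<close> inside the joins
    of \<open>\<tau>\<close> with faces of \<open>\<Phi> \<tau>\<close>; these joins absorb any
    point of \<open>\<tau>\<close> as apex.\<close>
  have "\<exists>D. D {} = 0 \<and> (\<forall>\<tau>\<in>S'. card \<tau> \<le> n \<longrightarrow>
      Poly_Mapping.keys (D \<tau>) \<subseteq> {\<sigma>\<in>\<Psi> \<tau>. card \<sigma> = card \<tau> + 1} \<and>
      simplicial_boundary (D \<tau>) = g \<tau> + (\<Sum>v\<in>\<tau>. D (\<tau> - {v})))"
  proof (rule carrier_chain_map)
    show "\<Psi> (\<tau> - {v}) \<subseteq> \<Psi> \<tau>" for \<tau> v by (rule \<Psi>_mono)
    show "\<tau> - {v} \<in> S'" if "\<tau> \<in> S'" for \<tau> v by (rule S'I[OF that])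
    show "simplicial_boundary 0 = g {}" by (simp add: g_def f0 push_chain_single)
  next
    fix \<tau> assume \<tau>: "\<tau> \<in> S'"
    show "finite \<tau>" by (rule S'(1)[OF \<tau>])
    show "Poly_Mapping.keys (g \<tau>) \<subseteq> {\<sigma> \<in> \<Psi> \<tau>. Suc (card \<sigma>) = card \<tau> + 1}"
    proof
      fix \<rho> assume "\<rho> \<in> Poly_Mapping.keys (g \<tau>)"
      from subsetD[OF Poly_Mapping.keys_add this[unfolded g_def]] consider "\<rho> = ?R ` \<tau>" | \<sigma> where "\<sigma> \<in> Poly_Mapping.keys (f \<tau>)" "\<rho> = ?L ` \<sigma>"
        using keys_push_chain[of "?L" "f \<tau>"] by (auto split: if_splits)
      then show "\<rho> \<in> {\<sigma> \<in> \<Psi> \<tau>. Suc (card \<sigma>) = card \<tau> + 1}"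
      proof cases
        case 1
        have "\<rho> = ?L ` {} \<union> ?R ` \<tau>" using 1 by simp
        then have "\<rho> \<in> \<Psi> \<tau>" using empty[of \<tau>] S'(1)[OF \<tau>] unfolding \<Psi>_def by blast
        then show ?thesis by (simp add: 1 card_image)
      next
        case 2
        have \<sigma>: "\<sigma> \<in> \<Phi> \<tau>" "card \<sigma> = card \<tau>" "finite \<sigma>"
          using fk[OF \<tau> 2(1)] \<Phi> Jf(1) by blast+
        have "\<rho> = ?L ` \<sigma> \<union> ?R ` {}" using 2 by simp
        then have "\<rho> \<in> \<Psi> \<tau>" using \<sigma> unfolding \<Psi>_def by blast
        then show ?thesis using \<sigma> by (simp add: 2 card_image)
      qed
    qed
    have "simplicial_boundary (Poly_Mapping.single (?R ` \<tau>) 1) =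
        (\<Sum>v\<in>\<tau>. Poly_Mapping.single (?R ` (\<tau> - {v})) (1::bit))"
      using boundary_push_chain[of "?R" "Poly_Mapping.single \<tau> 1"]
      by (simp add: push_chain_single push_chain_sum simplicial_boundary_single)
    moreover have "simplicial_boundary (push_chain ?L (f \<tau>)) = (\<Sum>v\<in>\<tau>. push_chain ?L (f (\<tau> - {v})))"
      using boundary_push_chain[of "?L" "f \<tau>"] by (simp add: df[OF \<tau>] push_chain_sum)
    ultimately show "simplicial_boundary (g \<tau>) = (\<Sum>v\<in>\<tau>. g (\<tau> - {v}))"
      by (simp add: g_def simplicial_boundary_add sum.distrib)
  next
    fix \<tau> z
    assume \<tau>: "\<tau> \<in> S'" "\<tau> \<noteq> {}" "card \<tau> \<le> n" and z: "simplicial_boundary z = 0"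
        "Poly_Mapping.keys z \<subseteq> {\<sigma> \<in> \<Psi> \<tau>. Suc (card \<sigma>) = card \<tau> + 1}"
    obtain y where y: "y \<in> \<tau>" using \<tau>(2) by blast
    have "finite \<rho> \<and> insert (?R y) \<rho> \<in> \<Psi> \<tau>" if \<rho>: "\<rho> \<in> \<Psi> \<tau>" for \<rho>
    proof -
      obtain \<tau>' \<sigma> where "finite \<rho>" "\<tau>' \<subseteq> \<tau>" "\<sigma> \<in> \<Phi> \<tau>" "\<rho> = ?L ` \<sigma> \<union> ?R ` \<tau>'"
        using \<rho> unfolding \<Psi>_def by blast
      moreover from this have "insert (?R y) \<rho> = ?L ` \<sigma> \<union> ?R ` insert y \<tau>'" by simp
      moreover have "insert y \<tau>' \<subseteq> \<tau>" using \<open>\<tau>' \<subseteq> \<tau>\<close> y by blast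
      ultimately show ?thesis unfolding \<Psi>_def by blast
    qed
    from cycle_bounds_if_cone_closed[OF z this]
    show "\<exists>u. Poly_Mapping.keys u \<subseteq> {\<sigma> \<in> \<Psi> \<tau>. card \<sigma> = card \<tau> + 1} \<and> simplicial_boundary u = z" .
  qed simp
  then obtain D where D: "\<forall>\<tau>\<in>S'. card \<tau> \<le> n \<longrightarrow>
      Poly_Mapping.keys (D \<tau>) \<subseteq> {\<sigma>\<in>\<Psi> \<tau>. card \<sigma> = card \<tau> + 1} \<and>
      simplicial_boundary (D \<tau>) = g \<tau> + (\<Sum>v\<in>\<tau>. D (\<tau> - {v}))"
    by (elim exE conjE)
  have Dk: "\<rho> \<in> \<Psi> \<tau> \<and> card \<rho> = card \<tau> + 1" if "\<tau> \<in> S'" "\<rho> \<in> Poly_Mapping.keys (D \<tau>)" for \<tau> \<rho>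
    using bspec[OF D that(1)] S'(3)[OF that(1)] that(2) by auto
  have dD: "simplicial_boundary (D \<tau>) = g \<tau> + (\<Sum>v\<in>\<tau>. D (\<tau> - {v}))" if "\<tau> \<in> S'" for \<tau>
    using bspec[OF D that] S'(3)[OF that] by blast

  \<comment> \<open>The boundary cycle of the simplex \<open>B\<close>; for \<open>n = 0\<close> it
    is the empty simplex, which is why \<open>S\<close> admits \<open>\<tau> = {}\<close>.\<close>
  define c0 where "c0 = simplicial_boundary (Poly_Mapping.single B (1::bit))"
  have dc0: "simplicial_boundary c0 = 0"
    unfolding c0_def by (rule simplicial_boundary_boundary) (use B(1) in simp)
  have c0k: "\<exists>b\<in>B. \<tau> = B - {b}" if "\<tau> \<in> Poly_Mapping.keys c0" for \<tau>
    using subsetD[OF keys_sum that[unfolded c0_def simplicial_boundary_single]] by auto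
  have c0f: "finite \<tau> \<and> card \<tau> = n" if "\<tau> \<in> Poly_Mapping.keys c0" for \<tau>
    using c0k[OF that] B(1,2) by (auto simp: card_Diff_singleton)
  \<comment> \<open>Half the Lebesgue number, because subdivision bounds diameters by a weak
    inequality and the Lebesgue property asks for a strict one.\<close>
  have "L / 2 > 0" using L(1) by simp
  from fine_subdivision[OF dc0 c0f this] obtain c h where dc: "simplicial_boundary c = 0"
    and dh: "simplicial_boundary h = c0 + c"
    and c: "\<And>\<rho>. \<rho> \<in> Poly_Mapping.keys c \<Longrightarrow> finite \<rho> \<and> card \<rho> = n \<and> diameter \<rho> \<le> L / 2 \<and>
       (\<exists>\<tau>\<in>Poly_Mapping.keys c0. \<rho> \<subseteq> convex hull \<tau>)"
    and h: "\<And>\<rho>. \<rho> \<in> Poly_Mapping.keys h \<Longrightarrow> finite \<rho> \<and> card \<rho> = Suc n \<and>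
       (\<exists>\<tau>\<in>Poly_Mapping.keys c0. \<rho> \<subseteq> convex hull \<tau>)"
    by metis
  have cS: "\<tau> \<in> S'" if \<tau>: "\<tau> \<in> Poly_Mapping.keys c" for \<tau>
  proof -
    have F: "\<tau> \<subseteq> F" using c[OF \<tau>] c0k by (fastforce simp: F_def)
    have "diameter \<tau> < L" using c[OF \<tau>] L(1) by auto
    from L(2)[OF F this] have "\<tau> = {} \<or> (\<exists>y\<in>F. \<tau> \<subseteq> O' y)" by auto
    then show ?thesis using F c[OF \<tau>] by (simp add: S'_def S_def)
  qed
  define fc where "fc = chain_ext f c"
  have dfc: "simplicial_boundary fc = 0"
    using boundary_chain_ext[of c f "\<lambda>_. 0", OF df[OF cS]] dc by (simp add: fc_def chain_ext_def)
  have fck: "Poly_Mapping.keys fc \<subseteq> {\<sigma>\<in>J. card \<sigma> = n}"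
  proof
    fix \<sigma> assume "\<sigma> \<in> Poly_Mapping.keys fc"
    then obtain \<tau> where \<tau>: "\<tau> \<in> Poly_Mapping.keys c" "\<sigma> \<in> Poly_Mapping.keys (f \<tau>)"
      using subsetD[OF keys_chain_ext] unfolding fc_def by blast
    then show "\<sigma> \<in> {\<sigma>\<in>J. card \<sigma> = n}" using fk[OF cS[OF \<tau>(1)] \<tau>(2)] c[OF \<tau>(1)] \<Phi> by auto
  qed
  \<comment> \<open>The cycle \<open>fc\<close> has dimension \<open>n - 1 \<le> d - 1\<close>, so
    the connectivity of \<open>J\<close> itself fills it.\<close>
  obtain u where u: "Poly_Mapping.keys u \<subseteq> {\<sigma>\<in>J. card \<sigma> = Suc n}" "simplicial_boundary u = fc"
    using homologically_connected_cycle_bounds[OF J conn _ dfc fck] nd by auto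
  have dDc: "simplicial_boundary (chain_ext D c) = push_chain ?R c + push_chain ?L fc"
  proof -
    have "simplicial_boundary (chain_ext D c) = chain_ext g c"
      using boundary_chain_ext[of c D g, OF dD[OF cS]] dc by simp
    also have "\<dots> = push_chain ?R c + push_chain ?L fc"
      unfolding g_def chain_ext_plus fc_def push_chain_def
      by (simp add: chain_ext_def[of _ c] chain_ext_sum)
    finally show ?thesis .
  qed
  \<comment> \<open>The three chains lead from \<open>c0\<close> to \<open>c\<close>, from
    \<open>c\<close> to \<open>fc\<close>, and from \<open>fc\<close> to zero; so \<open>w\<close>
    has the same boundary as \<open>B'\<close>, and \<open>z\<close> is a cycle.\<close>
  define w where "w = push_chain ?R h + chain_ext D c + push_chain ?L u"
  define B' :: "('v + 'e) set" where "B' = ?R ` B"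
  define z where "z = Poly_Mapping.single B' 1 + w"
  have dz: "simplicial_boundary z = 0"
  proof -
    have "simplicial_boundary (Poly_Mapping.single B' 1) = push_chain ?R c0"
      using boundary_push_chain[of "?R" "Poly_Mapping.single B 1"]
      by (simp add: push_chain_single B'_def c0_def)
    moreover have "simplicial_boundary (push_chain ?R h) = push_chain ?R c0 + push_chain ?R c"
      by (simp add: boundary_push_chain dh push_chain_add)
    moreover have "simplicial_boundary (push_chain ?L u) = push_chain ?L fc"
      by (simp add: boundary_push_chain u(2))
    ultimately have "simplicial_boundary z = (push_chain ?R c0 + push_chain ?R c0) +
        (push_chain ?R c + push_chain ?R c) + (push_chain ?L fc + push_chain ?L fc)"
      unfolding z_def w_def simplicial_boundary_add dDc by (simp only: ac_simps)
    then show ?thesis by simp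
  qed
  define ev where "ev = case_sum a (\<lambda>y. y)"
  have ev: "ev ` (?L ` \<sigma> \<union> ?R ` \<tau>) = a ` \<sigma> \<union> \<tau>" for \<sigma> \<tau>
    by (force simp: ev_def image_Un image_image)
  \<comment> \<open>Every simplex of \<open>w\<close> avoids the origin: those of \<open>h\<close>
    lie in facets of \<open>B\<close>, those of \<open>D\<close> are controlled by the half-space of
    one \<open>y\<close>, and those of \<open>u\<close> are faces of \<open>J\<close>.\<close>
  have wk: "finite \<rho> \<and> card \<rho> = Suc n \<and> ev ` \<rho> \<subseteq> W \<and> 0 \<notin> convex hull (ev ` \<rho>)"
    if \<rho>: "\<rho> \<in> Poly_Mapping.keys w" for \<rho>
  proof -
    have "\<rho> \<in> Poly_Mapping.keys (push_chain ?R h) \<union> Poly_Mapping.keys (chain_ext D c) \<union>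
        Poly_Mapping.keys (push_chain ?L u)"
      using subsetD[OF Poly_Mapping.keys_add \<rho>[unfolded w_def]]
        subsetD[OF Poly_Mapping.keys_add[of "push_chain ?R h" "chain_ext D c"], of \<rho>] by blast
    then have "\<rho> \<in> (`) ?R ` Poly_Mapping.keys h \<union> (\<Union>\<tau>\<in>Poly_Mapping.keys c. Poly_Mapping.keys (D \<tau>)) \<union>
        (`) ?L ` Poly_Mapping.keys u"
      by (rule subsetD[OF Un_mono[OF Un_mono[OF keys_push_chain keys_chain_ext] keys_push_chain]])
    then consider \<sigma> where "\<sigma> \<in> Poly_Mapping.keys h" "\<rho> = ?R ` \<sigma>"
      | \<tau> where "\<tau> \<in> Poly_Mapping.keys c" "\<rho> \<in> Poly_Mapping.keys (D \<tau>)"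
      | \<sigma> where "\<sigma> \<in> Poly_Mapping.keys u" "\<rho> = ?L ` \<sigma>"
      by (elim UnE imageE UN_E) simp_all
    then show ?thesis
    proof cases
      case 1
      have s: "finite \<sigma>" "card \<sigma> = Suc n" using h[OF 1(1)] by auto
      obtain b where b: "b \<in> B" "\<sigma> \<subseteq> convex hull (B - {b})" using h[OF 1(1)] c0k by blast
      have e: "ev ` \<rho> = \<sigma>" using ev[of "{}" \<sigma>] 1(2) by simp
      have "convex hull \<sigma> \<subseteq> convex hull (B - {b})"
        by (rule hull_minimal[OF b(2)]) (rule convex_convex_hull)
      then have "0 \<notin> convex hull \<sigma>" using B(6)[OF b(1)] by blast
      moreover have "\<sigma> \<subseteq> W" using b FW by (auto simp: F_def)
      ultimately show ?thesis using s e 1(2) by (simp add: card_image)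
    next
      case 2
      have \<tau>: "\<tau> \<in> S'" by (rule cS[OF 2(1)])
      have \<rho>: "\<rho> \<in> \<Psi> \<tau>" "card \<rho> = Suc n" using Dk[OF \<tau> 2(2)] c[OF 2(1)] by auto
      then obtain \<tau>' \<sigma> where \<rho>': "finite \<rho>" "\<tau>' \<subseteq> \<tau>" "\<sigma> \<in> \<Phi> \<tau>" "\<rho> = ?L ` \<sigma> \<union> ?R ` \<tau>'"
        unfolding \<Psi>_def by blast
      have e: "ev ` \<rho> = a ` \<sigma> \<union> \<tau>'" by (simp only: \<rho>'(4) ev)
      have \<sigma>: "\<sigma> \<in> J" "\<sigma> \<subseteq> U \<tau>" using \<Phi>[OF \<rho>'(3)] by auto
      have "0 \<notin> convex hull (a ` \<sigma> \<union> \<tau>')"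
      \<comment> \<open>The empty \<open>\<tau>\<close> arises only for \<open>n = 0\<close>; then
        only the images of a face of \<open>J\<close> remain.\<close>
      proof (cases "\<tau> = {}")
        case True
        then show ?thesis using J0[OF \<sigma>(1)] \<rho>'(2) by simp
      next
        case False
        then obtain y where y: "y \<in> F" "\<tau> \<subseteq> O' y" using S'(2)[OF \<tau>] by (auto simp: S_def)
        have "\<forall>v\<in>\<sigma>. 0 \<le> y \<bullet> a v"
        proof
          fix v assume "v \<in> \<sigma>"
          then obtain y' where "v \<in> X" "y' \<in> \<tau>" "0 \<le> y' \<bullet> a v" using \<sigma>(2) by (auto simp: U_def)
          then show "0 \<le> y \<bullet> a v" using Osub[OF y(1)] y(2) by blast
        qed
        from O0[OF y(1) \<sigma>(1) this] show ?thesis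
          using hull_mono[of "a ` \<sigma> \<union> \<tau>'" "a ` \<sigma> \<union> O' y" convex] y(2) \<rho>'(2) by blast
      qed
      moreover have "a ` \<sigma> \<union> \<tau>' \<subseteq> W"
        using aW Jf(2)[OF \<sigma>(1)] \<rho>'(2) S(2)[OF S'(2)[OF \<tau>]] FW by blast
      ultimately show ?thesis using \<rho>'(1) \<rho>(2) by (simp only: e) simp
    next
      case 3
      have \<sigma>: "\<sigma> \<in> J" "card \<sigma> = Suc n" using u(1) 3(1) by auto
      have e: "ev ` \<rho> = a ` \<sigma>" using ev[of \<sigma> "{}"] 3(2) by simp
      have "a ` \<sigma> \<subseteq> W" using aW Jf(2)[OF \<sigma>(1)] by blast
      then show ?thesis using \<sigma> J0[OF \<sigma>(1)] Jf(1)[OF \<sigma>(1)] e 3(2) by (simp add: card_image)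
    qed
  qed
  have evB: "ev ` B' = B" using ev[of "{}" B] by (simp add: B'_def)
  \<comment> \<open>Since \<open>B\<close> surrounds the origin, \<open>B'\<close> does not occur in
    \<open>w\<close> and is not cancelled in \<open>z\<close>.\<close>
  have "0 \<in> convex hull B" using B(4) B(5)[of 0] subspace_0[OF W(1)] by simp
  then have B'w: "B' \<notin> Poly_Mapping.keys w" using wk[of B'] evB by auto
  have zk: "Poly_Mapping.keys z = insert B' (Poly_Mapping.keys w)"
  proof -
    have "Poly_Mapping.lookup z \<rho> = (if \<rho> = B' then 1 else Poly_Mapping.lookup w \<rho>)" for \<rho>
      using B'w by (auto simp: z_def lookup_add lookup_single when_def in_keys_iff)
    then show ?thesis by (auto simp: in_keys_iff split: if_splits)
  qed
  have zf: "finite \<rho> \<and> card \<rho> = Suc n \<and> ev ` \<rho> \<subseteq> W" if "\<rho> \<in> Poly_Mapping.keys z" for \<rho>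
  proof (cases "\<rho> = B'")
    case True
    then show ?thesis using B(1,2,3) evB by (simp add: B'_def card_image)
  next
    case False
    then show ?thesis using wk[of \<rho>] that zk by simp
  qed
  define C where "C = (\<Union>\<rho>\<in>Poly_Mapping.keys w. convex hull (ev ` \<rho>))"
  have "closed C" unfolding C_def by (rule closed_union_hulls) (simp_all add: wk)
  moreover have "0 \<notin> C" using wk by (auto simp: C_def)
  ultimately obtain r where r: "r > 0" "\<And>x. x \<in> C \<Longrightarrow> r \<le> norm x"
    using closed_avoiding_zero_norm_bounded_below by blast
  \<comment> \<open>A norm below \<open>r\<close> keeps \<open>p\<close> off all simplices of
    \<open>w\<close>, and a norm below \<open>\<delta>\<close> keeps it inside \<open>B\<close>; so
    exactly one simplex of \<open>z\<close> covers \<open>p\<close>, which contradicts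
    evenness.\<close>
  have "finite (\<Union>(Poly_Mapping.keys z))" "min r \<delta> > 0" using zf r(1) B(4) by auto
  then obtain p where p: "p \<in> W" "norm p < min r \<delta>"
    "\<And>\<sigma>. \<sigma> \<subseteq> \<Union>(Poly_Mapping.keys z) \<Longrightarrow> card \<sigma> \<le> n \<Longrightarrow> p \<notin> convex hull (ev ` \<sigma>)"
    using generic_point_near_zero[OF _ W] by blast
  have "p \<in> convex hull (ev ` \<rho>) \<longleftrightarrow> \<rho> = B'" if "\<rho> \<in> Poly_Mapping.keys z" for \<rho>
  proof (cases "\<rho> = B'")
    case True
    then show ?thesis using B(5)[OF p(1)] p(2) evB by simp
  next
    case False
    then have "\<rho> \<in> Poly_Mapping.keys w" using that zk by simp
    then have "p \<notin> convex hull (ev ` \<rho>)" using r(2)[of p] p(2) by (auto simp: C_def)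
    with False show ?thesis by simp
  qed
  then have "{\<rho>\<in>Poly_Mapping.keys z. p \<in> convex hull (ev ` \<rho>)} = {B'}" using zk by blast
  moreover have "even (card {\<rho>\<in>Poly_Mapping.keys z. p \<in> convex hull (ev ` \<rho>)})"
    by (rule even_card_simplices_containing[OF dz zf W p(3)])
  ultimately show False by simp
qed

section \<open>From vertex images back to the affine map\<close>

lemma sum_scaleR_axis_component:
  fixes b :: "nat \<Rightarrow> 'v::finite"
  assumes "inj_on b {..<d}" "j < d"
  shows "(\<Sum>k<d. c k *\<^sub>R axis (b k) (1::real)) $ b j = c j"
proof -
  have "(\<Sum>k<d. c k *\<^sub>R axis (b k) (1::real)) $ b j = (\<Sum>k<d. if k = j then c k else 0)"
    unfolding sum_component using assms by (intro sum.cong) (auto simp: axis_def inj_on_def)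
  then show ?thesis using assms(2) by simp
qed

lemma affine_map_open_simplex:
  assumes "affine_map K d A" "\<sigma> \<in> K" "x \<in> open_simplex \<sigma>"
  shows "A x j = (\<Sum>v\<in>\<sigma>. x $ v * A (axis v 1) j)" and "j \<ge> d \<Longrightarrow> A x j = 0"
proof -
  have "x \<in> closed_simplex \<sigma>"
    using assms(3) rel_interior_subset unfolding open_simplex_def by blast
  then show "A x j = (\<Sum>v\<in>\<sigma>. x $ v * A (axis v 1) j)"
    using assms(1,2) unfolding affine_map_def by blast
  have "x \<in> geometric_realization K"
    using assms(2,3) unfolding geometric_realization_def by blast
  then have "A x \<in> topspace (Euclidean_space d)" using assms(1) unfolding affine_map_def by blast
  then show "j \<ge> d \<Longrightarrow> A x j = 0" by (simp add: topspace_Euclidean_space)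
qed

theorem theorem18:
  fixes d :: nat
    and V :: "nat \<Rightarrow> 'v::finite set"
    and K :: "'v set set"
    and A :: "real ^ 'v \<Rightarrow> nat \<Rightarrow> real"
  assumes "disjoint_family_on V {1..d+1}"
    and "K \<subseteq> colorful_join (d+1) V"
    and "Meshulam_admissible (d+1) V K"
    and "colorful_Caratheodory_map d V A"
  shows "\<exists>\<sigma>\<in>K. (\<lambda>_. 0) \<in> face_image A \<sigma>"
proof -
  let ?I = "{1..d+1}"
  define X where "X = (\<Union>i\<in>?I. V i)"
  have K: "simplicial_complex_on X K" and conn: "homologically_connected (int (d+1) - 2) K"
    and sub: "\<And>U. U \<subset> X \<Longrightarrow> \<forall>i\<in>?I. U \<inter> V i \<noteq> {} \<Longrightarrow>
      homologically_connected (int (d+1) - 3) (induced_subcomplex K U)"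
    using assms(3) unfolding Meshulam_admissible_def X_def by blast+
  have A: "affine_map (full_simplex X) d A"
    and zero: "\<And>i. i \<in> ?I \<Longrightarrow> (\<lambda>_. 0) \<in> face_image A (V i)"
    using assms(4) unfolding colorful_Caratheodory_map_def X_def by blast+
  \<comment> \<open>The barycentric coordinates of a point in the open simplex on \<open>V i\<close>
    that is mapped to the origin.\<close>
  have Vi: "\<exists>x. (\<forall>v\<in>V i. 0 < x $ v) \<and> (\<Sum>v\<in>V i. x $ v) = 1 \<and>
      (\<forall>j. (\<Sum>v\<in>V i. x $ v * A (axis v 1) j) = 0)" if i: "i \<in> ?I" for i
  proof -
    obtain x where x: "x \<in> open_simplex (V i)" "A x = (\<lambda>_. 0)"
      using zero[OF i] unfolding face_image_def by (metis (no_types, lifting) imageE)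
    have "V i \<in> full_simplex X" using i by (auto simp: full_simplex_def X_def)
    from affine_map_open_simplex(1)[OF A this x(1)] show ?thesis
      using x by (intro exI[of _ x]) (auto simp: open_simplex_iff)
  qed
  have ne: "V i \<noteq> {}" if i: "i \<in> ?I" for i using Vi[OF i] by auto
  \<comment> \<open>The \<open>d + 1\<close> disjoint nonempty classes provide more than
    \<open>d\<close> vertices, so the target embeds into \<open>real ^ 'v\<close> along
    \<open>d\<close> of its axes, selected by \<open>b\<close>.\<close>
  have "card ?I \<le> card X"
  proof -
    have "card ?I \<le> (\<Sum>i\<in>?I. card (V i))"
      using sum_mono[of ?I "\<lambda>_. 1" "\<lambda>i. card (V i)"] ne by (simp add: Suc_le_eq card_gt_0_iff)
    also have "\<dots> = card X"
      unfolding X_def using assms(1) by (intro card_UN_disjoint[symmetric]) (auto simp: disjoint_family_on_def)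
    finally show ?thesis .
  qed
  then have "card {..<d} \<le> card (UNIV :: 'v set)"
    using card_mono[of "UNIV :: 'v set" X] by simp
  then obtain b :: "nat \<Rightarrow> 'v" where b: "inj_on b {..<d}"
    using card_le_inj[of "{..<d}" "UNIV :: 'v set"] by auto
  \<comment> \<open>The vertex images, copied into a Euclidean space type; coordinate
    \<open>j\<close> is placed on the axis \<open>b j\<close>.\<close>
  define a :: "'v \<Rightarrow> real ^ 'v" where "a v = (\<Sum>j<d. A (axis v 1) j *\<^sub>R axis (b j) 1)" for v
  have comb: "(\<Sum>v\<in>S. l v *\<^sub>R a v) = (\<Sum>j<d. (\<Sum>v\<in>S. l v * A (axis v 1) j) *\<^sub>R axis (b j) 1)" for S l
    unfolding a_def by (simp add: scaleR_sum_right scaleR_sum_left) (rule sum.swap)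
  have "\<exists>\<sigma>\<in>K. 0 \<in> convex hull (a ` \<sigma>)"
  proof (rule colorful_face_containing_zero[OF X_def _ K])
    show "homologically_connected (int d - 1) K" using conn by simp
    show "homologically_connected (int d - 2) (induced_subcomplex K U)"
      if "U \<subset> X" "\<forall>i\<in>?I. U \<inter> V i \<noteq> {}" for U using sub[OF that] by simp
    show "\<exists>l. (\<forall>v\<in>V i. 0 < l v) \<and> (\<Sum>v\<in>V i. l v *\<^sub>R a v) = 0" if i: "i \<in> ?I" for i
    proof -
      obtain x where x: "\<forall>v\<in>V i. 0 < x $ v" "\<forall>j. (\<Sum>v\<in>V i. x $ v * A (axis v 1) j) = 0"
        using Vi[OF i] by blast
      then show ?thesis by (intro exI[of _ "\<lambda>v. x $ v"]) (simp add: comb)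
    qed
    have "a ` X \<subseteq> span ((\<lambda>j. axis (b j) 1) ` {..<d})"
    proof (rule image_subsetI)
      fix v assume "v \<in> X"
      show "a v \<in> span ((\<lambda>j. axis (b j) 1) ` {..<d})"
        unfolding a_def by (intro span_sum span_scale) (simp add: span_base)
    qed
    then have "dim (a ` X) \<le> card ((\<lambda>j. axis (b j) (1::real)) ` {..<d})"
      by (rule dim_le_card) simp
    also have "\<dots> \<le> d" using card_image_le[of "{..<d}" "\<lambda>j. axis (b j) (1::real)"] by simp
    finally show "dim (span (a ` X)) \<le> d" by simp
  qed (use ne in simp_all)
  then obtain \<sigma> where \<sigma>: "\<sigma> \<in> K" "0 \<in> convex hull (a ` \<sigma>)" by blast
  then obtain l where l: "\<forall>v\<in>\<sigma>. 0 \<le> l v" "sum l \<sigma> = 1" "(\<Sum>v\<in>\<sigma>. l v *\<^sub>R a v) = 0"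
    by (auto simp: convex_hull_image_iff)
  \<comment> \<open>Dropping the zero weights passes from the closed hull to the open simplex of a
    smaller face, which still belongs to \<open>K\<close>.\<close>
  define \<tau> where "\<tau> = {v\<in>\<sigma>. 0 < l v}"
  have \<tau>: "\<tau> \<subseteq> \<sigma>" "\<And>v. v \<in> \<sigma> - \<tau> \<Longrightarrow> l v = 0" using l(1) by (auto simp: \<tau>_def less_le)
  have \<tau>K: "\<tau> \<in> K" "\<tau> \<in> full_simplex X"
    using K \<sigma>(1) \<tau>(1) unfolding simplicial_complex_on_def full_simplex_def by blast+
  define x :: "real ^ 'v" where "x = (\<chi> v. if v \<in> \<tau> then l v else 0)"
  have "sum l \<tau> = 1"
    using sum.mono_neutral_left[of \<sigma> \<tau> l] \<tau> l(2) by simp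
  then have x: "x \<in> open_simplex \<tau>" by (auto simp: open_simplex_iff x_def \<tau>_def)
  have "A x j = 0" for j
  \<comment> \<open>Coordinates below \<open>d\<close> are read off from the axes
    \<open>b j\<close>; the others vanish on the whole target.\<close>
  proof (cases "j < d")
    case True
    have "A x j = (\<Sum>v\<in>\<tau>. l v * A (axis v 1) j)"
      unfolding affine_map_open_simplex(1)[OF A \<tau>K(2) x] by (simp add: x_def)
    also have "\<dots> = (\<Sum>v\<in>\<sigma>. l v * A (axis v 1) j)"
      by (rule sum.mono_neutral_left) (use \<tau> in auto)
    also have "\<dots> = (\<Sum>v\<in>\<sigma>. l v *\<^sub>R a v) $ b j"
      unfolding comb using sum_scaleR_axis_component[OF b True] by simp
    finally show ?thesis using l(3) by simp
  next
    case False
    then show ?thesis using affine_map_open_simplex(2)[OF A \<tau>K(2) x] by simp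
  qed
  then have "A x = (\<lambda>_. 0)" by blast
  then show ?thesis using \<tau>K(1) x unfolding face_image_def by (metis image_eqI)
qed

end
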